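(* Let $c_1>|c_2|$. All four equilibria in $\mathfrak{t}_3\cap\operatorname{Orb}_{c_1;c_2}$ of the $\mathfrak{so}(4)$ rigid body equations are non-degenerate of center-center type and therefore nonlinearly stable on the corresponding adjoint orbit $\operatorname{Orb}_{c_1;c_2}$. These equilibria are also nonlinearly stable for the Lie-Poisson dynamics on $\mathfrak{so}(4)$.
   Context: Let $\lambda_1>\lambda_2>\lambda_3>\lambda_4$ be real numbers with $\lambda_i+\lambda_j>0$ for $i\ne j$, and $J=\operatorname{diag}(\lambda_1,\lambda_2,\lambda_3,\lambda_4)$. The Lie-Poisson dynamics of the $\mathfrak{so}(4)$ rigid body is $\dot M=[M,\Omega]$ on $\mathfrak{so}(4)$ (real antisymmetric $4\times4$ matrices), where $\Omega\in\mathfrak{so}(4)$ is determined by $M=J\Omega+\Omega J$. Write $$M=\begin{bmatrix}0&-x_3&x_2&y_1\\ x_3&0&-x_1&y_2\\ -x_2&x_1&0&y_3\\ -y_1&-y_2&-y_3&0\end{bmatrix}.$$ The following are constants of motion: $C_1=\frac12(\sum x_i^2+\sum y_i^2)$, $C_2=\sum x_iy_i$ (Casimirs), $$H=\tfrac12\left(\tfrac{x_1^2}{\lambda_2+\lambda_3}+\tfrac{x_2^2}{\lambda_1+\lambda_3}+\tfrac{x_3^2}{\lambda_1+\lambda_2}+\tfrac{y_1^2}{\lambda_1+\lambda_4}+\tfrac{y_2^2}{\lambda_2+\lambda_4}+\tfrac{y_3^2}{\lambda_3+\lambda_4}\right),$$ $$I=(\lambda_2^2+\lambda_3^2)x_1^2+(\lambda_1^2+\lambda_3^2)x_2^2+(\lambda_1^2+\lambda_2^2)x_3^2+(\lambda_1^2+\lambda_4^2)y_1^2+(\lambda_2^2+\lambda_4^2)y_2^2+(\lambda_3^2+\lambda_4^2)y_3^2.$$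 For $c_1>|c_2|$, $\operatorname{Orb}_{c_1;c_2}=\{M\mid C_1(M)=c_1,\,C_2(M)=c_2\}$ is a four-dimensional regular adjoint orbit of $\operatorname{SO}(4)$, invariant under the dynamics, with orbit symplectic form $\omega$, $\omega(M)([M,X],[M,Y])=\frac12\operatorname{Trace}(M[X,Y])$. For a function $F$ on $\mathfrak{so}(4)$, the Hamiltonian vector field of $F|_{\operatorname{Orb}_{c_1;c_2}}$ is $X_{F|_{\operatorname{Orb}_{c_1;c_2}}}(M)=[M,\nabla F(M)]$, with the gradient taken relative to $\langle X,Y\rangle=-\frac12\operatorname{Trace}(XY)$; for $F=H$ this is the restriction of the rigid body equation. $M^3_{p,q}$ is the matrix with $x_3=p$, $y_3=q$, $x_1=x_2=y_1=y_2=0$, and $\mathfrak{t}_3=\{M^3_{p,q}\mid p,q\in\mathbb{R}\}$. The set $\mathfrak{t}_3\cap\operatorname{Orb}_{c_1;c_2}$ consists of the four equilibria $M^3_{a,b},M^3_{-a,-b},M^3_{b,a},M^3_{-b,-a}$ with $a=\frac{1}{\sqrt2}(\sqrt{c_1+c_2}+\sqrt{c_1-c_2})$, $b=\frac{1}{\sqrt2}(\sqrt{c_1+c_2}-\sqrt{c_1-c_2})$. An equilibrium $M\in\operatorname{Orb}_{c_1;c_2}$ at which the differentials of both $H|_{\operatorname{Orb}_{c_1;c_2}}$ and $I|_{\operatorname{Orb}_{c_1;c_2}}$ vanish is called non-degenerate if the (commuting) linearizations $\mathbf{D}X_{H|_{\operatorname{Orb}_{c_1;c_2}}}(M)$ and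 $\mathbf{D}X_{I|_{\operatorname{Orb}_{c_1;c_2}}}(M)$ generate a Cartan subalgebra of the Lie algebra of infinitesimally symplectic linear maps of $(T_M\operatorname{Orb}_{c_1;c_2},\omega(M))$. It is of center-center type if this Cartan subalgebra is conjugate to the algebra of matrices $$\begin{bmatrix} 0&0&-A&0 \\ 0&0&0&-B \\ A&0&0&0 \\ 0&B&0&0 \end{bmatrix},\quad A,B\in\mathbb{R}$$ (eigenvalues $\pm iA,\pm iB$). Nonlinear stability means Lyapunov stability. *)

theory Defs
  imports "HOL-Analysis.Analysis"
begin

type_synonym mat4 = "real^4^4"

definition so4 :: "mat4 set" where
  "so4 = {M. transpose M = - M}"

definition lie :: "mat4 \<Rightarrow> mat4 \<Rightarrow> mat4" where
  "lie A B = A ** B - B ** A"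

definition ip :: "mat4 \<Rightarrow> mat4 \<Rightarrow> real" where
  "ip X Y = - (1/2) * trace (X ** Y)"

definition so4_mat :: "real \<Rightarrow> real \<Rightarrow> real \<Rightarrow> real \<Rightarrow> real \<Rightarrow> real \<Rightarrow> mat4" where
  "so4_mat x1 x2 x3 y1 y2 y3 = vector [
     vector [  0, -x3,  x2, y1],
     vector [ x3,   0, -x1, y2],
     vector [-x2,  x1,   0, y3],
     vector [-y1, -y2, -y3,  0]]"

text \<open>The coordinates of \<open>so4_mat x1 x2 x3 y1 y2 y3\<close>, read off from its entries.\<close>

definition x1 :: "mat4 \<Rightarrow> real" where "x1 M = M $ 3 $ 2"
definition x2 :: "mat4 \<Rightarrow> real" where "x2 M = M $ 1 $ 3"
definition x3 :: "mat4 \<Rightarrow> real" where "x3 M = M $ 2 $ 1"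
definition y1 :: "mat4 \<Rightarrow> real" where "y1 M = M $ 1 $ 4"
definition y2 :: "mat4 \<Rightarrow> real" where "y2 M = M $ 2 $ 4"
definition y3 :: "mat4 \<Rightarrow> real" where "y3 M = M $ 3 $ 4"

definition J_mat :: "real^4 \<Rightarrow> mat4" where
  "J_mat l = (\<chi> i j. if i = j then l $ i else 0)"

definition Omega :: "real^4 \<Rightarrow> mat4 \<Rightarrow> mat4" where
  "Omega l M = (THE W. W \<in> so4 \<and> M = J_mat l ** W + W ** J_mat l)"

definition rigid_body :: "real^4 \<Rightarrow> mat4 \<Rightarrow> mat4" where
  "rigid_body l M = lie M (Omega l M)"

definition C1 :: "mat4 \<Rightarrow> real" where
  "C1 M = 1/2 * (((x1 M)\<^sup>2 + (x2 M)\<^sup>2 + (x3 M)\<^sup>2) + ((y1 M)\<^sup>2 + (y2 M)\<^sup>2 + (y3 M)\<^sup>2))"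

definition C2 :: "mat4 \<Rightarrow> real" where
  "C2 M = x1 M * y1 M + x2 M * y2 M + x3 M * y3 M"

definition ham_H :: "real^4 \<Rightarrow> mat4 \<Rightarrow> real" where
  "ham_H l M = 1/2 *
     ((x1 M)\<^sup>2 / (l$2 + l$3) + (x2 M)\<^sup>2 / (l$1 + l$3) + (x3 M)\<^sup>2 / (l$1 + l$2)
    + (y1 M)\<^sup>2 / (l$1 + l$4) + (y2 M)\<^sup>2 / (l$2 + l$4) + (y3 M)\<^sup>2 / (l$3 + l$4))"

definition int_I :: "real^4 \<Rightarrow> mat4 \<Rightarrow> real" where
  "int_I l M =
     ((l$2)\<^sup>2 + (l$3)\<^sup>2) * (x1 M)\<^sup>2 + ((l$1)\<^sup>2 + (l$3)\<^sup>2) * (x2 M)\<^sup>2 + ((l$1)\<^sup>2 + (l$2)\<^sup>2) * (x3 M)\<^sup>2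
   + ((l$1)\<^sup>2 + (l$4)\<^sup>2) * (y1 M)\<^sup>2 + ((l$2)\<^sup>2 + (l$4)\<^sup>2) * (y2 M)\<^sup>2 + ((l$3)\<^sup>2 + (l$4)\<^sup>2) * (y3 M)\<^sup>2"

definition Orb :: "real \<Rightarrow> real \<Rightarrow> mat4 set" where
  "Orb c1 c2 = {M \<in> so4. C1 M = c1 \<and> C2 M = c2}"

definition tangent :: "mat4 \<Rightarrow> mat4 set" where
  "tangent M = {lie M X | X. X \<in> so4}"

definition omega :: "mat4 \<Rightarrow> mat4 \<Rightarrow> mat4 \<Rightarrow> real" where
  "omega M U V = (THE r. \<exists>X\<in>so4. \<exists>Y\<in>so4.
      U = lie M X \<and> V = lie M Y \<and> r = 1/2 * trace (M ** lie X Y))"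

text \<open>Derivatives are taken within \<open>so4\<close>, so that only the restriction of \<open>F\<close> to \<open>so4\<close> matters.\<close>

definition grad :: "(mat4 \<Rightarrow> real) \<Rightarrow> mat4 \<Rightarrow> mat4" where
  "grad F M = (THE G. G \<in> so4 \<and> (F has_derivative (\<lambda>X. ip G X)) (at M within so4))"

definition ham_vf :: "(mat4 \<Rightarrow> real) \<Rightarrow> mat4 \<Rightarrow> mat4" where
  "ham_vf F M = lie M (grad F M)"

text \<open>The differential at \<open>M\<close> of the restriction of \<open>F\<close> to the orbit through \<open>M\<close> is
  \<open>V \<mapsto> \<langle>\<nabla>F(M), V\<rangle>\<close> on the tangent space of the orbit.\<close>

definition critical_on_orbit :: "(mat4 \<Rightarrow> real) \<Rightarrow> mat4 \<Rightarrow> bool" where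
  "critical_on_orbit F M \<longleftrightarrow> (\<forall>V\<in>tangent M. ip (grad F M) V = 0)"

text \<open>A linear endomorphism of a subspace \<open>V\<close> is represented by its unique extension to the
  ambient space that vanishes on the orthogonal complement of \<open>V\<close>; this representation respects
  linear combinations and composition.\<close>

definition End_on :: "'a::euclidean_space set \<Rightarrow> ('a \<Rightarrow>\<^sub>L 'a) set" where
  "End_on V = {L. (\<forall>u. blinfun_apply L u \<in> V) \<and> (\<forall>u\<in>orthogonal_comp V. blinfun_apply L u = 0)}"

definition commutator :: "('a::real_normed_vector \<Rightarrow>\<^sub>L 'a) \<Rightarrow> ('a \<Rightarrow>\<^sub>L 'a) \<Rightarrow> ('a \<Rightarrow>\<^sub>L 'a)" where
  "commutator L K = (L o\<^sub>L K) - (K o\<^sub>L L)"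

definition symp_alg :: "'a::euclidean_space set \<Rightarrow> ('a \<Rightarrow> 'a \<Rightarrow> real) \<Rightarrow> ('a \<Rightarrow>\<^sub>L 'a) set" where
  "symp_alg V w = {L \<in> End_on V. \<forall>u\<in>V. \<forall>v\<in>V.
      w (blinfun_apply L u) v + w u (blinfun_apply L v) = 0}"

definition lie_subalgebra :: "('e::real_vector \<Rightarrow> 'e \<Rightarrow> 'e) \<Rightarrow> 'e set \<Rightarrow> bool" where
  "lie_subalgebra br h \<longleftrightarrow> subspace h \<and> (\<forall>a\<in>h. \<forall>b\<in>h. br a b \<in> h)"

definition lie_generated :: "('e::real_vector \<Rightarrow> 'e \<Rightarrow> 'e) \<Rightarrow> 'e set \<Rightarrow> 'e set" where
  "lie_generated br S = \<Inter>{h. lie_subalgebra br h \<and> S \<subseteq> h}"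

fun lower_central :: "('e::real_vector \<Rightarrow> 'e \<Rightarrow> 'e) \<Rightarrow> 'e set \<Rightarrow> nat \<Rightarrow> 'e set" where
  "lower_central br h 0 = h"
| "lower_central br h (Suc n) = span {br a b | a b. a \<in> h \<and> b \<in> lower_central br h n}"

definition lie_nilpotent :: "('e::real_vector \<Rightarrow> 'e \<Rightarrow> 'e) \<Rightarrow> 'e set \<Rightarrow> bool" where
  "lie_nilpotent br h \<longleftrightarrow> (\<exists>n. lower_central br h n = {0})"

definition cartan_subalgebra ::
  "('e::real_vector \<Rightarrow> 'e \<Rightarrow> 'e) \<Rightarrow> 'e set \<Rightarrow> 'e set \<Rightarrow> bool" where
  "cartan_subalgebra br g h \<longleftrightarrow> h \<subseteq> g \<and> lie_subalgebra br h \<and> lie_nilpotent br h \<and>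
     {a \<in> g. \<forall>b\<in>h. br a b \<in> h} = h"

text \<open>The linearization at \<open>M\<close> of the restriction of \<open>X\<close> to the orbit through \<open>M\<close>, as an
  endomorphism of the tangent space of the orbit.\<close>

definition linearization :: "(mat4 \<Rightarrow> mat4) \<Rightarrow> mat4 \<Rightarrow> (mat4 \<Rightarrow>\<^sub>L mat4)" where
  "linearization X M = (THE L. L \<in> End_on (tangent M) \<and>
     (\<exists>D. (X has_derivative D) (at M within so4) \<and> (\<forall>v\<in>tangent M. blinfun_apply L v = D v)))"

definition linearizations_algebra :: "real^4 \<Rightarrow> mat4 \<Rightarrow> (mat4 \<Rightarrow>\<^sub>L mat4) set" where
  "linearizations_algebra l M = lie_generated commutator
     {linearization (ham_vf (ham_H l)) M, linearization (ham_vf (int_I l)) M}"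

definition nondegenerate :: "real^4 \<Rightarrow> real \<Rightarrow> real \<Rightarrow> mat4 \<Rightarrow> bool" where
  "nondegenerate l c1 c2 M \<longleftrightarrow>
     M \<in> Orb c1 c2 \<and> rigid_body l M = 0 \<and>
     critical_on_orbit (ham_H l) M \<and> critical_on_orbit (int_I l) M \<and>
     cartan_subalgebra commutator (symp_alg (tangent M) (omega M)) (linearizations_algebra l M)"

definition cc_matrix :: "real \<Rightarrow> real \<Rightarrow> real^4^4" where
  "cc_matrix A B = vector [
     vector [0, 0, -A,  0],
     vector [0, 0,  0, -B],
     vector [A, 0,  0,  0],
     vector [0, B,  0,  0]]"

definition std_symp :: "real^4 \<Rightarrow> real^4 \<Rightarrow> real" where
  "std_symp u v = u$1 * v$3 + u$2 * v$4 - u$3 * v$1 - u$4 * v$2"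

text \<open>Conjugacy is by a linear symplectic isomorphism from the standard symplectic space to
  \<open>(V, w)\<close>.\<close>

definition center_center_algebra ::
  "'a::euclidean_space set \<Rightarrow> ('a \<Rightarrow> 'a \<Rightarrow> real) \<Rightarrow> ('a \<Rightarrow>\<^sub>L 'a) set \<Rightarrow> bool" where
  "center_center_algebra V w h \<longleftrightarrow> (\<exists>\<phi>::real^4 \<Rightarrow> 'a.
     linear \<phi> \<and> bij_betw \<phi> UNIV V \<and> (\<forall>u v. w (\<phi> u) (\<phi> v) = std_symp u v) \<and>
     h = {L \<in> End_on V. \<exists>A B. \<forall>u. blinfun_apply L (\<phi> u) = \<phi> (cc_matrix A B *v u)})"

definition nondegenerate_center_center :: "real^4 \<Rightarrow> real \<Rightarrow> real \<Rightarrow> mat4 \<Rightarrow> bool" where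
  "nondegenerate_center_center l c1 c2 M \<longleftrightarrow> nondegenerate l c1 c2 M \<and>
     center_center_algebra (tangent M) (omega M) (linearizations_algebra l M)"

definition solution_on ::
  "('a::real_normed_vector \<Rightarrow> 'a) \<Rightarrow> 'a set \<Rightarrow> real \<Rightarrow> (real \<Rightarrow> 'a) \<Rightarrow> bool" where
  "solution_on f S T \<gamma> \<longleftrightarrow>
     (\<forall>t\<in>{0..T}. \<gamma> t \<in> S \<and> (\<gamma> has_vector_derivative f (\<gamma> t)) (at t within {0..T}))"

text \<open>Lyapunov stability of the equilibrium \<open>p\<close> for \<open>f\<close> on the invariant set \<open>S\<close>. All solutions on
  all intervals \<open>[0, T]\<close> are considered, so global existence of solutions plays no role.\<close>

definition lyapunov_stable ::
  "('a::real_normed_vector \<Rightarrow> 'a) \<Rightarrow> 'a set \<Rightarrow> 'a \<Rightarrow> bool" where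
  "lyapunov_stable f S p \<longleftrightarrow> p \<in> S \<and> f p = 0 \<and>
     (\<forall>\<epsilon>>0. \<exists>\<delta>>0. \<forall>T\<ge>0. \<forall>\<gamma>. solution_on f S T \<gamma> \<and> dist (\<gamma> 0) p < \<delta> \<longrightarrow>
        (\<forall>t\<in>{0..T}. dist (\<gamma> t) p < \<epsilon>))"

definition M3 :: "real \<Rightarrow> real \<Rightarrow> mat4" where
  "M3 p q = so4_mat 0 0 p 0 0 q"

definition t3 :: "mat4 set" where
  "t3 = {M3 p q | p q. True}"

end

theory Submission
  imports Defs
begin

text \<open>
  The integrals \<open>H\<close>, \<open>I\<close> and \<open>C1\<close> belong to one linear family, the Manakov integrals: for a
  vector \<open>b\<close> of four numbers, the coordinate of \<open>M\<close> in the \<open>(i, j)\<close> plane is squared and weighted with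
  \<open>(b\<^sub>i - b\<^sub>j) / (\<lambda>\<^sub>i\<^sup>2 - \<lambda>\<^sub>j\<^sup>2)\<close>.  Up to scalar factors \<open>b = \<lambda>\<close> gives \<open>H\<close>, \<open>b = \<lambda>\<^sup>4\<close> gives \<open>I\<close> and
  \<open>b = \<lambda>\<^sup>2\<close> gives \<open>C1\<close>; constant \<open>b\<close> gives \<open>0\<close>.  Modulo constants and \<open>\<lambda>\<^sup>2\<close> the family has
  dimension two, and \<open>H\<close>, \<open>I\<close> span it because \<open>\<lambda>\<^sub>1 + \<lambda>\<^sub>2 + \<lambda>\<^sub>3 + \<lambda>\<^sub>4 \<noteq> 0\<close> (\<open>H_I_independent\<close>).

  The decisive member is \<open>b = (0, 0, -1, -1)\<close>.  It is the positive combination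
  \<open>x\<^sub>1\<^sup>2 / (\<lambda>\<^sub>2\<^sup>2 - \<lambda>\<^sub>3\<^sup>2) + x\<^sub>2\<^sup>2 / (\<lambda>\<^sub>1\<^sup>2 - \<lambda>\<^sub>3\<^sup>2) + y\<^sub>1\<^sup>2 / (\<lambda>\<^sub>1\<^sup>2 - \<lambda>\<^sub>4\<^sup>2) + y\<^sub>2\<^sup>2 / (\<lambda>\<^sub>2\<^sup>2 - \<lambda>\<^sub>4\<^sup>2)\<close>, up to the
  factor \<open>1/2\<close>: it contains neither \<open>x\<^sub>3\<close> nor \<open>y\<^sub>3\<close> and vanishes on \<open>so4\<close> exactly along \<open>t3\<close>.  Call it \<open>F\<close>.

  Stability: \<open>F + (C1 - c1)\<^sup>2 + (C2 - c2)\<^sup>2\<close> is conserved on the whole of \<open>so4\<close>, nonnegative, and its zero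
  set is the finite set \<open>t3 \<inter> Orb c1 c2\<close>.  Each of the equilibria is therefore an isolated minimum of
  a conserved function (\<open>lyapunov_stable_isolated_minimum\<close>); stability on the orbit follows by
  restriction.

  Non-degeneracy: the orbit's tangent space at an equilibrium has the coordinates \<open>x\<^sub>1, x\<^sub>2, y\<^sub>1, y\<^sub>2\<close>, on
  which \<open>F\<close> is a positive definite quadratic form.  As in Williamson's theorem, a symplectic basis
  brings the linearization of \<open>X\<^sub>F\<close> to the center-center form \<open>cc_matrix A B\<close>
  (\<open>definite_center_center_frame\<close>), with \<open>A\<close>, \<open>B\<close> nonzero and \<open>A\<^sup>2 \<noteq> B\<^sup>2\<close>.  An infinitesimally symplectic
  map commuting with such a matrix is itself of center-center form (\<open>cc_matrix_normaliser\<close>).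
  The linearizations of \<open>X\<^sub>H\<close> and \<open>X\<^sub>I\<close> are
  combinations of the one of \<open>X\<^sub>F\<close> and of one further commuting, linearly independent map; hence they
  span the algebra of all center-center maps, which is its own normalizer
  (\<open>cc_algebra_generated\<close>).
\<close>

section \<open>Endomorphisms of a subspace\<close>

lemma vector_4 [simp]:
  "(vector [a,b,c,d] :: 'a::zero^4) $ 1 = a"
  "(vector [a,b,c,d] :: 'a::zero^4) $ 2 = b"
  "(vector [a,b,c,d] :: 'a::zero^4) $ 3 = c"
  "(vector [a,b,c,d] :: 'a::zero^4) $ 4 = d"
  by (simp_all add: vector_def)

text \<open>The extension by zero leaves no freedom off \<open>V\<close>, because \<open>V\<close> and its orthogonal complement span
  the ambient space.\<close>

lemma End_on_eqI:
  assumes "subspace V" "L \<in> End_on V" "K \<in> End_on V"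
    and eq: "\<And>v. v \<in> V \<Longrightarrow> blinfun_apply L v = blinfun_apply K v"
  shows "L = K"
proof (rule blinfun_eqI)
  fix x
  obtain y z where yz: "y \<in> span V" "\<And>w. w \<in> span V \<Longrightarrow> orthogonal z w" "x = y + z"
    by (rule orthogonal_subspace_decomp_exists[of V x]) auto
  have "y \<in> V" using yz(1) assms(1) by (metis span_eq_iff)
  moreover have "z \<in> orthogonal_comp V"
    using yz(2) by (auto simp: orthogonal_comp_def orthogonal_commute span_base)
  ultimately show "blinfun_apply L x = blinfun_apply K x"
    using assms(2,3) eq by (auto simp: yz(3) blinfun.add_right End_on_def)
qed

lemma End_on_maps: "L \<in> End_on V \<Longrightarrow> blinfun_apply L u \<in> V"
  by (simp add: End_on_def)

lemma subspace_End_on: "subspace V \<Longrightarrow> subspace (End_on V)"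
  by (rule subspaceI)
    (auto simp: End_on_def blinfun.add_left blinfun.scaleR_left
       subspace_add subspace_scale subspace_0)

section \<open>The center-center algebra\<close>

lemma cc_matrix_mult_vec:
  "cc_matrix A B *v u = vector [- A * u$3, - B * u$4, A * u$1, B * u$2]"
  by (simp add: cc_matrix_def vec_eq_iff forall_4 matrix_vector_mult_def sum_4)

lemma matrix_mult_vec_4:
  fixes m :: "real^4^4"
  shows "(m *v u) $ i = m$i$1 * u$1 + m$i$2 * u$2 + m$i$3 * u$3 + m$i$4 * u$4"
  by (simp add: matrix_vector_mult_def sum_4)

lemma commutator_apply:
  "blinfun_apply (commutator L K) u =
     blinfun_apply L (blinfun_apply K u) - blinfun_apply K (blinfun_apply L u)"
  by (simp add: commutator_def blinfun.diff_left)

text \<open>Entrywise, the bracket with \<open>cc_matrix A B\<close> couples the off-diagonal-block entries of \<open>m\<close> in pairs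
  \<open>(x, y)\<close> through \<open>A y = B x\<close>, \<open>B y = A x\<close>, so they vanish if \<open>A\<^sup>2 \<noteq> B\<^sup>2\<close>.  In each of the two
  \<open>2 \<times> 2\<close> blocks the bracket forces the form \<open>(\<sigma>, -\<tau>; \<tau>, \<sigma>)\<close>, and \<open>\<sigma> = 0\<close> because an infinitesimally
  symplectic map has trace zero on a symplectic plane that it preserves.  The
  right-hand side \<open>cc_matrix C D\<close> covers the normalizer, its value \<open>0\<close> the centralizer.\<close>

lemma cc_matrix_normaliser:
  fixes m :: "real^4^4"
  assumes AB: "A \<noteq> 0" "B \<noteq> 0" "A\<^sup>2 \<noteq> B\<^sup>2"
    and br: "\<And>u. m *v (cc_matrix A B *v u) - cc_matrix A B *v (m *v u) = cc_matrix C D *v u"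
    and sp: "\<And>u v. std_symp (m *v u) v + std_symp u (m *v v) = 0"
  shows "m = cc_matrix (m$3$1) (m$4$2)"
proof -
  have E: "(m *v (cc_matrix A B *v axis j 1)) $ i
      = (cc_matrix A B *v (m *v axis j 1)) $ i + (cc_matrix C D *v axis j 1) $ i" for i j
    using arg_cong[OF br[of "axis j 1"], of "\<lambda>x. x $ i"] by simp
  note E' = E[unfolded matrix_mult_vec_4[of m] cc_matrix_mult_vec axis_def]
  have br1: "m$1$3 * A = - (A * m$3$1)" "m$1$4 * B = - (A * m$3$2)"
      "m$3$3 * A = A * m$1$1 + C" "- (m$1$1 * A) = - (A * m$3$3) - C"
      "- (m$1$2 * B) = - (A * m$3$4)" "m$3$4 * B = A * m$1$2"
      "- (m$3$2 * B) = A * m$1$4"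
      "m$2$4 * B = - (B * m$4$2)" "m$2$3 * A = - (B * m$4$1)"
      "m$4$4 * B = B * m$2$2 + D" "- (m$2$2 * B) = - (B * m$4$4) - D"
      "- (m$2$1 * A) = - (B * m$4$3)" "m$4$3 * A = B * m$2$1"
      "- (m$4$1 * A) = B * m$2$3"
    using E'[of 1 1] E'[of 1 2] E'[of 3 1] E'[of 1 3] E'[of 1 4] E'[of 3 2] E'[of 3 4]
      E'[of 2 2] E'[of 2 1] E'[of 4 2] E'[of 2 4] E'[of 2 3] E'[of 4 1] E'[of 4 3]
    by simp_all
  have S: "m$1$1 + m$3$3 = 0" "m$2$2 + m$4$4 = 0"
    using sp[of "axis 1 1" "axis 3 1"] sp[of "axis 2 1" "axis 4 1"]
    by (simp_all add: std_symp_def matrix_mult_vec_4 axis_def)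
  have z: "x = 0 \<and> y = 0" if "A * y = B * x" "B * y = A * x" for x y
  proof -
    have "(A\<^sup>2 - B\<^sup>2) * x = 0" "(A\<^sup>2 - B\<^sup>2) * y = 0"
      using that by algebra+
    then show ?thesis using AB(3) by simp
  qed
  have 1: "m$1$1 = m$3$3" "m$2$2 = m$4$4" "m$1$3 = - m$3$1" "m$2$4 = - m$4$2"
    using br1 AB by (auto simp: algebra_simps) algebra+
  have 2: "m$1$2 = 0 \<and> m$3$4 = 0" "m$2$1 = 0 \<and> m$4$3 = 0"
    "m$1$4 = 0 \<and> - m$3$2 = 0" "m$2$3 = 0 \<and> - m$4$1 = 0"
    by (rule z; use br1 in \<open>simp add: algebra_simps\<close>)+
  show ?thesis
    using 1 2 S by (simp add: vec_eq_iff forall_4 cc_matrix_def)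
qed

definition cc_algebra :: "'a::euclidean_space set \<Rightarrow> (real^4 \<Rightarrow> 'a) \<Rightarrow> ('a \<Rightarrow>\<^sub>L 'a) set" where
  "cc_algebra V \<phi> = {L \<in> End_on V. \<exists>A B. \<forall>u. blinfun_apply L (\<phi> u) = \<phi> (cc_matrix A B *v u)}"

lemma cc_matrix_lincomb:
  "cc_matrix (s * A + t * A') (s * B + t * B') *v u =
     s *\<^sub>R (cc_matrix A B *v u) + t *\<^sub>R (cc_matrix A' B' *v u)"
  by (simp add: cc_matrix_mult_vec vec_eq_iff forall_4 algebra_simps)

lemma cc_matrix_commute:
  "cc_matrix A B *v (cc_matrix A' B' *v u) = cc_matrix A' B' *v (cc_matrix A B *v u)"
  by (simp add: cc_matrix_mult_vec vec_eq_iff forall_4 algebra_simps)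

lemma cc_matrix_std_symp:
  "std_symp (cc_matrix A B *v u) v + std_symp u (cc_matrix A B *v v) = 0"
  by (simp add: cc_matrix_mult_vec std_symp_def algebra_simps)

locale symplectic_frame =
  fixes V :: "'a::euclidean_space set" and w :: "'a \<Rightarrow> 'a \<Rightarrow> real" and \<phi> :: "real^4 \<Rightarrow> 'a"
  assumes linear_frame: "linear \<phi>"
    and bij_frame: "bij_betw \<phi> UNIV V"
    and symplectic_frame: "w (\<phi> u) (\<phi> v) = std_symp u v"
begin

lemma subspace_V: "subspace V"
  using linear_subspace_image[OF linear_frame subspace_UNIV] bij_frame by (simp add: bij_betw_def)

lemma frame_mem: "\<phi> u \<in> V"
  using bij_frame by (auto simp: bij_betw_def)

lemma frame_eq_iff: "\<phi> u = \<phi> v \<longleftrightarrow> u = v"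
  using bij_frame by (auto simp: bij_betw_def inj_eq)

lemma frame_surj:
  assumes "v \<in> V" obtains u where "v = \<phi> u"
  using assms bij_frame by (auto simp: bij_betw_def)

lemma End_on_frame_eqI:
  assumes "L \<in> End_on V" "K \<in> End_on V"
    and "\<And>u. blinfun_apply L (\<phi> u) = blinfun_apply K (\<phi> u)"
  shows "L = K"
  using assms subspace_V by (auto intro: End_on_eqI elim: frame_surj)

lemma End_on_matrix:
  assumes "L \<in> End_on V"
  obtains m :: "real^4^4" where "\<And>u. blinfun_apply L (\<phi> u) = \<phi> (m *v u)"
proof -
  obtain \<psi> where \<psi>: "linear \<psi>" "\<And>u. \<psi> (\<phi> u) = u"
    using linear_injective_left_inverse[OF linear_frame] bij_frame
    by (auto simp: bij_betw_def fun_eq_iff)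
  let ?f = "\<psi> \<circ> (blinfun_apply L \<circ> \<phi>)"
  have lin: "linear ?f"
    by (intro linear_compose[OF _ \<psi>(1)] linear_compose[OF linear_frame]
        bounded_linear.linear[OF blinfun.bounded_linear_right])
  have "\<phi> (\<psi> v) = v" if "v \<in> V" for v
    using that \<psi>(2) by (auto elim: frame_surj)
  then have "blinfun_apply L (\<phi> u) = \<phi> (matrix ?f *v u)" for u
    using End_on_maps[OF assms] matrix_vector_mul(2)[OF lin] by (metis comp_apply)
  then show ?thesis using that by blast
qed

lemma cc_algebraI:
  "\<lbrakk>L \<in> End_on V; \<And>u. blinfun_apply L (\<phi> u) = \<phi> (cc_matrix A B *v u)\<rbrakk> \<Longrightarrow> L \<in> cc_algebra V \<phi>"
  by (auto simp: cc_algebra_def)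

lemma cc_algebraE:
  assumes "L \<in> cc_algebra V \<phi>"
  obtains A B where "L \<in> End_on V" "\<And>u. blinfun_apply L (\<phi> u) = \<phi> (cc_matrix A B *v u)"
  using assms by (auto simp: cc_algebra_def)

lemma lincomb_frame:
  assumes "\<And>u. blinfun_apply L (\<phi> u) = \<phi> (cc_matrix A B *v u)"
    and "\<And>u. blinfun_apply K (\<phi> u) = \<phi> (cc_matrix A' B' *v u)"
  shows "blinfun_apply (s *\<^sub>R L + t *\<^sub>R K) (\<phi> u) =
    \<phi> (cc_matrix (s * A + t * A') (s * B + t * B') *v u)"
  unfolding cc_matrix_lincomb
  by (simp add: assms blinfun.add_left blinfun.scaleR_left
      linear_add[OF linear_frame] linear_scale[OF linear_frame])

lemma cc_algebra_lincomb:
  assumes "L \<in> cc_algebra V \<phi>" "K \<in> cc_algebra V \<phi>"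
  shows "s *\<^sub>R L + t *\<^sub>R K \<in> cc_algebra V \<phi>"
proof -
  obtain A B A' B' where
    "L \<in> End_on V" "\<And>u. blinfun_apply L (\<phi> u) = \<phi> (cc_matrix A B *v u)"
    "K \<in> End_on V" "\<And>u. blinfun_apply K (\<phi> u) = \<phi> (cc_matrix A' B' *v u)"
    using assms by (elim cc_algebraE) blast
  then show ?thesis
    by (intro cc_algebraI[OF _ lincomb_frame])
      (auto intro: subspace_add subspace_scale subspace_End_on subspace_V)
qed

lemma subspace_cc_algebra:
  assumes "L \<in> cc_algebra V \<phi>"
  shows "subspace (cc_algebra V \<phi>)"
proof (rule subspaceI)
  show "0 \<in> cc_algebra V \<phi>" using cc_algebra_lincomb[OF assms assms, of 0 0] by simp
next
  fix x y assume "x \<in> cc_algebra V \<phi>" "y \<in> cc_algebra V \<phi>"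
  then show "x + y \<in> cc_algebra V \<phi>" using cc_algebra_lincomb[of x y 1 1] by simp
next
  fix c x assume "x \<in> cc_algebra V \<phi>"
  then show "c *\<^sub>R x \<in> cc_algebra V \<phi>" using cc_algebra_lincomb[of x x c 0] by simp
qed

lemma cc_algebra_commute:
  assumes "L \<in> cc_algebra V \<phi>" "K \<in> cc_algebra V \<phi>"
  shows "commutator L K = 0"
proof (rule End_on_frame_eqI)
  show "commutator L K \<in> End_on V"
    using assms subspace_V
    by (auto simp: cc_algebra_def End_on_def commutator_apply subspace_diff blinfun.zero_right)
  show "0 \<in> End_on V" by (rule subspace_0[OF subspace_End_on[OF subspace_V]])
  fix u
  obtain A B A' B' where
    "\<And>u. blinfun_apply L (\<phi> u) = \<phi> (cc_matrix A B *v u)"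
    "\<And>u. blinfun_apply K (\<phi> u) = \<phi> (cc_matrix A' B' *v u)"
    using assms by (elim cc_algebraE) blast
  then show "blinfun_apply (commutator L K) (\<phi> u) = blinfun_apply 0 (\<phi> u)"
    by (simp add: commutator_apply cc_matrix_commute)
qed

lemma cc_algebra_subset_symp_alg: "cc_algebra V \<phi> \<subseteq> symp_alg V w"
  by (auto simp: symp_alg_def cc_algebra_def symplectic_frame cc_matrix_std_symp elim!: frame_surj)

lemma cc_algebra_normaliser:
  assumes "K \<in> symp_alg V w" "A \<noteq> 0" "B \<noteq> 0" "A\<^sup>2 \<noteq> B\<^sup>2"
    and L: "\<And>u. blinfun_apply L (\<phi> u) = \<phi> (cc_matrix A B *v u)"
    and "commutator K L \<in> cc_algebra V \<phi>"
  shows "K \<in> cc_algebra V \<phi>"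
proof -
  have K: "K \<in> End_on V" using assms(1) by (simp add: symp_alg_def)
  obtain m where m: "\<And>u. blinfun_apply K (\<phi> u) = \<phi> (m *v u)"
    using End_on_matrix[OF K] by blast
  obtain C D where CD: "\<And>u. blinfun_apply (commutator K L) (\<phi> u) = \<phi> (cc_matrix C D *v u)"
    using assms(6) by (elim cc_algebraE) blast
  have "m = cc_matrix (m$3$1) (m$4$2)"
  proof (rule cc_matrix_normaliser[OF assms(2-4)])
    show "m *v (cc_matrix A B *v u) - cc_matrix A B *v (m *v u) = cc_matrix C D *v u" for u
      using CD[of u] by (simp add: commutator_apply m L frame_eq_iff flip: linear_diff[OF linear_frame])
    fix u v
    have "w (blinfun_apply K (\<phi> u)) (\<phi> v) + w (\<phi> u) (blinfun_apply K (\<phi> v)) = 0"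
      using assms(1) frame_mem by (simp add: symp_alg_def)
    then show "std_symp (m *v u) v + std_symp u (m *v v) = 0"
      by (simp only: m symplectic_frame)
  qed
  then show ?thesis using cc_algebraI[OF K] m by metis
qed

text \<open>The criterion used for the linearizations \<open>K1\<close>, \<open>K2\<close> of \<open>X\<^sub>H\<close>, \<open>X\<^sub>I\<close>.  Only \<open>L\<close> has to be put into normal
  form explicitly: \<open>L'\<close> commutes with it and is therefore of center-center form too, and two independent
  elements span the two-dimensional algebra.  That this algebra is Cartan comes from its being abelian
  and, by the normalizer lemma for \<open>L\<close> alone, self-normalizing.\<close>

theorem cc_algebra_generated:
  assumes L: "L \<in> End_on V" "\<And>u. blinfun_apply L (\<phi> u) = \<phi> (cc_matrix A B *v u)"
    and AB: "A \<noteq> 0" "B \<noteq> 0" "A\<^sup>2 \<noteq> B\<^sup>2"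
    and L': "L' \<in> symp_alg V w" "commutator L' L = 0" "\<And>k. L' \<noteq> k *\<^sub>R L"
    and K: "K1 = s1 *\<^sub>R L + t1 *\<^sub>R L'" "K2 = s2 *\<^sub>R L + t2 *\<^sub>R L'"
    and det: "s1 * t2 \<noteq> s2 * t1"
  shows "lie_generated commutator {K1, K2} = cc_algebra V \<phi>"
    and "cartan_subalgebra commutator (symp_alg V w) (cc_algebra V \<phi>)"
proof -
  let ?h = "cc_algebra V \<phi>"
  have Lh: "L \<in> ?h" by (rule cc_algebraI[OF L])
  note sub = subspace_cc_algebra[OF Lh]
  have L'h: "L' \<in> ?h"
    by (rule cc_algebra_normaliser[OF L'(1) AB L(2)]) (simp add: L'(2) subspace_0[OF sub])
  then obtain A' B' where L'': "L' \<in> End_on V" "\<And>u. blinfun_apply L' (\<phi> u) = \<phi> (cc_matrix A' B' *v u)"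
    by (elim cc_algebraE) blast
  have lie: "lie_subalgebra commutator ?h"
    by (simp add: lie_subalgebra_def sub cc_algebra_commute subspace_0)
  have indep: "A * B' - A' * B \<noteq> 0"
  proof
    assume eq: "A * B' - A' * B = 0"
    have "L' = (A' / A) *\<^sub>R L + 0 *\<^sub>R L"
    proof (rule End_on_frame_eqI[OF L''(1)])
      show "(A' / A) *\<^sub>R L + 0 *\<^sub>R L \<in> End_on V"
        using L(1) subspace_V by (simp add: subspace_End_on subspace_scale)
      have "A' / A * A + 0 * A = A'" "A' / A * B + 0 * B = B'"
        using AB(1) eq by (simp_all add: nonzero_divide_eq_eq mult.commute)
      then show "blinfun_apply L' (\<phi> u) = blinfun_apply ((A' / A) *\<^sub>R L + 0 *\<^sub>R L) (\<phi> u)" for u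
        unfolding lincomb_frame[OF L(2) L(2)] L''(2) by simp
    qed
    then show False using L'(3) by simp
  qed
  show "lie_generated commutator {K1, K2} = ?h"
  proof
    have "{K1, K2} \<subseteq> ?h" using Lh L'h by (simp add: K cc_algebra_lincomb)
    then show "lie_generated commutator {K1, K2} \<subseteq> ?h"
      using lie by (auto simp: lie_generated_def)
    show "?h \<subseteq> lie_generated commutator {K1, K2}"
    proof
      fix M assume "M \<in> ?h"
      then obtain C D where M: "M \<in> End_on V" "\<And>u. blinfun_apply M (\<phi> u) = \<phi> (cc_matrix C D *v u)"
        by (elim cc_algebraE) blast
      \<comment> \<open>Cramer's rule, first for \<open>M\<close> in terms of \<open>L, L'\<close>, then for \<open>L, L'\<close> in terms of \<open>K1, K2\<close>.\<close>
      define s where "s = (C * B' - A' * D) / (A * B' - A' * B)"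
      define t where "t = (A * D - C * B) / (A * B' - A' * B)"
      have "(C * B' - A' * D) * A + (A * D - C * B) * A' = C * (A * B' - A' * B)"
        "(C * B' - A' * D) * B + (A * D - C * B) * B' = D * (A * B' - A' * B)"
        by algebra+
      then have st: "s * A + t * A' = C" "s * B + t * B' = D"
        using indep by (simp_all add: s_def t_def nonzero_divide_eq_eq flip: add_divide_distrib)
      have MLL: "M = s *\<^sub>R L + t *\<^sub>R L'"
      proof (rule End_on_frame_eqI[OF M(1)])
        show "s *\<^sub>R L + t *\<^sub>R L' \<in> End_on V"
          using L(1) L''(1) subspace_V by (intro subspace_add subspace_scale subspace_End_on)
        show "blinfun_apply M (\<phi> u) = blinfun_apply (s *\<^sub>R L + t *\<^sub>R L') (\<phi> u)" for u
          unfolding lincomb_frame[OF L(2) L''(2)] M(2) st ..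
      qed
      define d where "d = s1 * t2 - s2 * t1"
      have d: "d \<noteq> 0" using det by (simp add: d_def)
      have "t2 *\<^sub>R K1 - t1 *\<^sub>R K2 = d *\<^sub>R L" "s1 *\<^sub>R K2 - s2 *\<^sub>R K1 = d *\<^sub>R L'"
        by (simp_all add: K d_def algebra_simps)
      then have LL: "L = (1/d) *\<^sub>R (t2 *\<^sub>R K1 - t1 *\<^sub>R K2)" "L' = (1/d) *\<^sub>R (s1 *\<^sub>R K2 - s2 *\<^sub>R K1)"
        using d by simp_all
      show "M \<in> lie_generated commutator {K1, K2}"
        unfolding lie_generated_def
      proof safe
        fix h assume h: "lie_subalgebra commutator h" "{K1, K2} \<subseteq> h"
        then have "subspace h" by (simp add: lie_subalgebra_def)
        with h(2) have "L \<in> h" "L' \<in> h"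
          unfolding LL by (auto intro!: subspace_scale subspace_diff)
        with \<open>subspace h\<close> show "M \<in> h"
          unfolding MLL by (auto intro!: subspace_add subspace_scale)
      qed
    qed
  qed
  have "{commutator a b |a b. a \<in> ?h \<and> b \<in> ?h} \<subseteq> {0}"
    using cc_algebra_commute by auto
  then have "{commutator a b |a b. a \<in> ?h \<and> b \<in> ?h} = {0}"
    using cc_algebra_commute[OF Lh Lh] Lh by force
  then have "span {commutator a b |a b. a \<in> ?h \<and> b \<in> ?h} = {0}"
    by (metis span_empty span_insert_0)
  then have "lower_central commutator ?h 1 = {0}"
    by (simp only: One_nat_def lower_central.simps)
  then have "lie_nilpotent commutator ?h"
    unfolding lie_nilpotent_def by blast
  moreover have "{a \<in> symp_alg V w. \<forall>b\<in>?h. commutator a b \<in> ?h} = ?h"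
  proof (intro equalityI subsetI)
    fix a assume "a \<in> {a \<in> symp_alg V w. \<forall>b\<in>?h. commutator a b \<in> ?h}"
    then have "a \<in> symp_alg V w" "commutator a L \<in> ?h" using Lh by simp_all
    then show "a \<in> ?h" using cc_algebra_normaliser[OF _ AB L(2)] by blast
  next
    fix a assume "a \<in> ?h"
    then show "a \<in> {a \<in> symp_alg V w. \<forall>b\<in>?h. commutator a b \<in> ?h}"
      using cc_algebra_subset_symp_alg cc_algebra_commute subspace_0[OF sub] by fastforce
  qed
  ultimately show "cartan_subalgebra commutator (symp_alg V w) ?h"
    unfolding cartan_subalgebra_def using lie cc_algebra_subset_symp_alg by simp
qed

end

section \<open>The Lie algebra in coordinates\<close>

lemma so4_mat_entries [simp]:
  "so4_mat a1 a2 a3 b1 b2 b3 $ 1 $ 1 = 0" "so4_mat a1 a2 a3 b1 b2 b3 $ 1 $ 2 = - a3"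
  "so4_mat a1 a2 a3 b1 b2 b3 $ 1 $ 3 = a2" "so4_mat a1 a2 a3 b1 b2 b3 $ 1 $ 4 = b1"
  "so4_mat a1 a2 a3 b1 b2 b3 $ 2 $ 1 = a3" "so4_mat a1 a2 a3 b1 b2 b3 $ 2 $ 2 = 0"
  "so4_mat a1 a2 a3 b1 b2 b3 $ 2 $ 3 = - a1" "so4_mat a1 a2 a3 b1 b2 b3 $ 2 $ 4 = b2"
  "so4_mat a1 a2 a3 b1 b2 b3 $ 3 $ 1 = - a2" "so4_mat a1 a2 a3 b1 b2 b3 $ 3 $ 2 = a1"
  "so4_mat a1 a2 a3 b1 b2 b3 $ 3 $ 3 = 0" "so4_mat a1 a2 a3 b1 b2 b3 $ 3 $ 4 = b3"
  "so4_mat a1 a2 a3 b1 b2 b3 $ 4 $ 1 = - b1" "so4_mat a1 a2 a3 b1 b2 b3 $ 4 $ 2 = - b2"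
  "so4_mat a1 a2 a3 b1 b2 b3 $ 4 $ 3 = - b3" "so4_mat a1 a2 a3 b1 b2 b3 $ 4 $ 4 = 0"
  by (simp_all add: so4_mat_def)

lemma so4_mat_coords [simp]:
  "x1 (so4_mat a1 a2 a3 b1 b2 b3) = a1" "x2 (so4_mat a1 a2 a3 b1 b2 b3) = a2"
  "x3 (so4_mat a1 a2 a3 b1 b2 b3) = a3" "y1 (so4_mat a1 a2 a3 b1 b2 b3) = b1"
  "y2 (so4_mat a1 a2 a3 b1 b2 b3) = b2" "y3 (so4_mat a1 a2 a3 b1 b2 b3) = b3"
  by (simp_all add: x1_def x2_def x3_def y1_def y2_def y3_def)

lemma so4_mat_eq_iff:
  "so4_mat a1 a2 a3 b1 b2 b3 = so4_mat a1' a2' a3' b1' b2' b3' \<longleftrightarrow>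
     a1 = a1' \<and> a2 = a2' \<and> a3 = a3' \<and> b1 = b1' \<and> b2 = b2' \<and> b3 = b3'"
  by (auto simp: vec_eq_iff forall_4)

lemma so4_mat_in_so4 [simp]: "so4_mat a1 a2 a3 b1 b2 b3 \<in> so4"
  by (simp add: so4_def vec_eq_iff forall_4 transpose_def)

lemma so4_mat_of_coords:
  assumes "M \<in> so4" shows "so4_mat (x1 M) (x2 M) (x3 M) (y1 M) (y2 M) (y3 M) = M"
proof -
  have *: "M $ j $ i = - (M $ i $ j)" for i j
  proof -
    have "transpose M $ i $ j = (- M) $ i $ j" using assms by (simp add: so4_def)
    then show ?thesis by (simp only: transpose_def vec_lambda_beta uminus_vec_def)
  qed
  have "M $ i $ i = 0" for i using *[of i i] by simp
  then show ?thesis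
    by (simp add: vec_eq_iff forall_4 x1_def x2_def x3_def y1_def y2_def y3_def
        *[of 2 1] *[of 1 3] *[of 3 2] *[of 1 4] *[of 2 4] *[of 3 4])
qed

lemma so4E:
  assumes "M \<in> so4" obtains a1 a2 a3 b1 b2 b3 where "M = so4_mat a1 a2 a3 b1 b2 b3"
  using so4_mat_of_coords[OF assms] by metis

lemma subspace_so4: "subspace so4"
proof (rule subspaceI)
  have [simp]: "transpose (X + Y) = transpose X + transpose Y"
      "transpose (c *\<^sub>R X) = c *\<^sub>R transpose X" "transpose 0 = (0 :: mat4)"
    for X Y :: mat4 and c
    by (simp_all add: transpose_def vec_eq_iff)
  show "0 \<in> so4" "\<And>X Y. X \<in> so4 \<Longrightarrow> Y \<in> so4 \<Longrightarrow> X + Y \<in> so4" "\<And>c X. X \<in> so4 \<Longrightarrow> c *\<^sub>R X \<in> so4"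
    by (simp_all add: so4_def)
qed

lemma lie_so4_mat:
  "lie (so4_mat a1 a2 a3 b1 b2 b3) (so4_mat c1 c2 c3 d1 d2 d3) =
   so4_mat (a2 * c3 - a3 * c2 + (b2 * d3 - b3 * d2)) (a3 * c1 - a1 * c3 + (b3 * d1 - b1 * d3))
     (a1 * c2 - a2 * c1 + (b1 * d2 - b2 * d1))
     (a2 * d3 - a3 * d2 + (b2 * c3 - b3 * c2)) (a3 * d1 - a1 * d3 + (b3 * c1 - b1 * c3))
     (a1 * d2 - a2 * d1 + (b1 * c2 - b2 * c1))"
  by (simp add: lie_def vec_eq_iff forall_4 matrix_matrix_mult_def sum_4 algebra_simps)

lemma trace_so4_mat:
  "trace (so4_mat a1 a2 a3 b1 b2 b3 ** so4_mat c1 c2 c3 d1 d2 d3) =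
     - 2 * (a1 * c1 + a2 * c2 + a3 * c3 + b1 * d1 + b2 * d2 + b3 * d3)"
  by (simp add: trace_def matrix_matrix_mult_def sum_4)

lemma ip_so4_mat:
  "ip (so4_mat a1 a2 a3 b1 b2 b3) (so4_mat c1 c2 c3 d1 d2 d3) =
     a1 * c1 + a2 * c2 + a3 * c3 + b1 * d1 + b2 * d2 + b3 * d3"
  unfolding ip_def trace_so4_mat by algebra

lemma bounded_linear_coords:
  "bounded_linear x1" "bounded_linear x2" "bounded_linear x3"
  "bounded_linear y1" "bounded_linear y2" "bounded_linear y3"
  unfolding x1_def[abs_def] x2_def[abs_def] x3_def[abs_def] y1_def[abs_def] y2_def[abs_def] y3_def[abs_def]
  by (intro bounded_linear_compose[OF bounded_linear_vec_nth] bounded_linear_vec_nth)+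

lemmas linear_coords = bounded_linear_coords[THEN bounded_linear.linear]

lemmas coords_linear [simp] =
  linear_coords[THEN linear_add] linear_coords[THEN linear_diff]
  linear_coords[THEN linear_scale] linear_coords[THEN linear_0]

lemma bounded_bilinear_lie: "bounded_bilinear lie"
proof -
  have "bilinear lie"
    unfolding bilinear_def
    by (auto intro!: linearI simp: lie_def vec_eq_iff forall_4 matrix_matrix_mult_def sum_4 algebra_simps)
  then show ?thesis by (simp add: bilinear_conv_bounded_bilinear)
qed

lemma bounded_linear_ip: "bounded_linear (ip G)"
proof -
  have "linear (ip G)"
  proof (rule linearI)
    show "ip G (X + Y) = ip G X + ip G Y" for X Y
      by (simp add: ip_def trace_def matrix_matrix_mult_def sum_4 algebra_simps)
    show "ip G (c *\<^sub>R X) = c *\<^sub>R ip G X" for c X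
      by (simp add: ip_def trace_def matrix_matrix_mult_def sum_4 algebra_simps)
  qed
  then show ?thesis by (simp add: linear_conv_bounded_linear)
qed

text \<open>A derivative within \<open>so4\<close> is a linear map on all matrices, of which only the values on \<open>so4\<close> are
  determined; this rule and the next one make that precise.  Restriction to the line \<open>t \<mapsto> p + t v\<close>
  reduces uniqueness to the one-variable case.\<close>

lemma has_derivative_within_subspace_unique:
  fixes f :: "'a::real_normed_vector \<Rightarrow> 'b::real_normed_vector"
  assumes "subspace S" "p \<in> S" "v \<in> S"
    and "(f has_derivative D) (at p within S)" "(f has_derivative D') (at p within S)"
  shows "D v = D' v"
proof -
  let ?c = "\<lambda>t::real. p + t *\<^sub>R v"
  have c: "(?c has_derivative (\<lambda>t. t *\<^sub>R v)) (at 0)"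
    by (auto intro!: derivative_eq_intros)
  have sub: "range ?c \<subseteq> S"
    using assms(1-3) by (auto intro!: subspace_add subspace_scale)
  have "((\<lambda>t. f (?c t)) has_derivative (\<lambda>t. E (t *\<^sub>R v))) (at 0)"
    if "(f has_derivative E) (at p within S)" for E
    using has_derivative_in_compose[OF c, of f E] has_derivative_subset[OF that sub] by simp
  from has_derivative_unique[OF this[OF assms(4)] this[OF assms(5)]]
  show ?thesis by (metis scaleR_one)
qed

lemma has_derivative_within_cong:
  assumes "(f has_derivative D) (at p within S)" "subspace S" "p \<in> S" "bounded_linear D'"
    and "\<And>v. v \<in> S \<Longrightarrow> D v = D' v"
  shows "(f has_derivative D') (at p within S)"
proof -
  have "((\<lambda>y. (1 / norm (y - p)) *\<^sub>R (f y - (f p + D (y - p)))) \<longlongrightarrow> 0) (at p within S)"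
    using assms(1) by (simp add: has_derivative_within)
  also have "?this \<longleftrightarrow> ((\<lambda>y. (1 / norm (y - p)) *\<^sub>R (f y - (f p + D' (y - p)))) \<longlongrightarrow> 0) (at p within S)"
    using assms(2,3,5) by (intro tendsto_cong) (auto simp: eventually_at_filter subspace_diff)
  finally show ?thesis using assms(4) by (simp add: has_derivative_within)
qed

section \<open>Diagonal quadratic integrals\<close>

definition quad :: "real^3 \<Rightarrow> real^3 \<Rightarrow> mat4 \<Rightarrow> real" where
  "quad \<alpha> \<beta> M = 1/2 * (\<alpha>$1 * (x1 M)\<^sup>2 + \<alpha>$2 * (x2 M)\<^sup>2 + \<alpha>$3 * (x3 M)\<^sup>2
     + (\<beta>$1 * (y1 M)\<^sup>2 + \<beta>$2 * (y2 M)\<^sup>2 + \<beta>$3 * (y3 M)\<^sup>2))"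

definition quad_grad :: "real^3 \<Rightarrow> real^3 \<Rightarrow> mat4 \<Rightarrow> mat4" where
  "quad_grad \<alpha> \<beta> M = so4_mat (\<alpha>$1 * x1 M) (\<alpha>$2 * x2 M) (\<alpha>$3 * x3 M)
     (\<beta>$1 * y1 M) (\<beta>$2 * y2 M) (\<beta>$3 * y3 M)"

lemma quad_grad_so4_mat:
  "quad_grad \<alpha> \<beta> (so4_mat a1 a2 a3 b1 b2 b3) =
     so4_mat (\<alpha>$1 * a1) (\<alpha>$2 * a2) (\<alpha>$3 * a3) (\<beta>$1 * b1) (\<beta>$2 * b2) (\<beta>$3 * b3)"
  by (simp add: quad_grad_def)

lemma quad_grad_in_so4 [simp]: "quad_grad \<alpha> \<beta> M \<in> so4"
  by (simp add: quad_grad_def)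

lemma bounded_linear_quad_grad: "bounded_linear (quad_grad \<alpha> \<beta>)"
proof -
  have "linear (quad_grad \<alpha> \<beta>)"
    by (rule linearI) (simp_all add: quad_grad_def vec_eq_iff forall_4 algebra_simps)
  then show ?thesis by (simp add: linear_conv_bounded_linear)
qed

lemma grad_eqI:
  assumes "M \<in> so4" "G \<in> so4" "(F has_derivative ip G) (at M within so4)"
  shows "grad F M = G"
  unfolding grad_def
proof (rule the_equality)
  show "G \<in> so4 \<and> (F has_derivative ip G) (at M within so4)" using assms by simp
  fix G' assume G': "G' \<in> so4 \<and> (F has_derivative ip G') (at M within so4)"
  have eq: "ip G' V = ip G V" if "V \<in> so4" for V
    using has_derivative_within_subspace_unique[OF subspace_so4 assms(1) that] G' assms(3) by blast
  obtain a1 a2 a3 b1 b2 b3 where G: "G = so4_mat a1 a2 a3 b1 b2 b3" using assms(2) by (rule so4E)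
  obtain c1 c2 c3 d1 d2 d3 where G2: "G' = so4_mat c1 c2 c3 d1 d2 d3" using G' so4E by blast
  show "G' = G"
    using eq[of "so4_mat 1 0 0 0 0 0"] eq[of "so4_mat 0 1 0 0 0 0"] eq[of "so4_mat 0 0 1 0 0 0"]
      eq[of "so4_mat 0 0 0 1 0 0"] eq[of "so4_mat 0 0 0 0 1 0"] eq[of "so4_mat 0 0 0 0 0 1"]
    by (simp add: G G2 ip_so4_mat)
qed

lemma quad_has_derivative:
  assumes "M \<in> so4"
  shows "(quad \<alpha> \<beta> has_derivative ip (quad_grad \<alpha> \<beta> M)) (at M within so4)"
proof -
  note d = bounded_linear_coords[THEN bounded_linear.has_derivative[OF _ has_derivative_ident]]
  let ?D = "\<lambda>X. \<alpha>$1 * x1 M * x1 X + \<alpha>$2 * x2 M * x2 X + \<alpha>$3 * x3 M * x3 X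
     + \<beta>$1 * y1 M * y1 X + \<beta>$2 * y2 M * y2 X + \<beta>$3 * y3 M * y3 X"
  have "(quad \<alpha> \<beta> has_derivative ?D) (at M within so4)"
    unfolding quad_def[abs_def]
    by (auto intro!: derivative_eq_intros d simp: algebra_simps)
  then show ?thesis
    by (rule has_derivative_within_cong[OF _ subspace_so4 assms bounded_linear_ip])
      (use so4E in \<open>force simp: quad_grad_def ip_so4_mat\<close>)
qed

lemma grad_quad: "M \<in> so4 \<Longrightarrow> grad (quad \<alpha> \<beta>) M = quad_grad \<alpha> \<beta> M"
  by (rule grad_eqI[OF _ quad_grad_in_so4 quad_has_derivative])

lemma ham_vf_quad: "M \<in> so4 \<Longrightarrow> ham_vf (quad \<alpha> \<beta>) M = lie M (quad_grad \<alpha> \<beta> M)"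
  by (simp add: ham_vf_def grad_quad)

lemma ham_vf_quad_has_derivative:
  assumes "M \<in> so4"
  shows "(ham_vf (quad \<alpha> \<beta>) has_derivative
     (\<lambda>X. lie M (quad_grad \<alpha> \<beta> X) + lie X (quad_grad \<alpha> \<beta> M))) (at M within so4)"
proof (rule has_derivative_transform[OF assms])
  show "ham_vf (quad \<alpha> \<beta>) N = lie N (quad_grad \<alpha> \<beta> N)" if "N \<in> so4" for N
    by (rule ham_vf_quad[OF that])
  show "((\<lambda>N. lie N (quad_grad \<alpha> \<beta> N)) has_derivative
     (\<lambda>X. lie M (quad_grad \<alpha> \<beta> X) + lie X (quad_grad \<alpha> \<beta> M))) (at M within so4)"
    by (intro bounded_bilinear.FDERIV[OF bounded_bilinear_lie] has_derivative_ident
        bounded_linear.has_derivative[OF bounded_linear_quad_grad])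
qed

section \<open>The orbit at an equilibrium\<close>

text \<open>At \<open>M3 p q\<close> the tangent space of the orbit consists of the matrices with \<open>x\<^sub>3 = y\<^sub>3 = 0\<close>.  The condition
  \<open>p\<^sup>2 \<noteq> q\<^sup>2\<close> expresses that the orbit is regular, \<open>c1 > \<bar>c2\<bar>\<close>; the bracket with \<open>M3 p q\<close> is then
  invertible on this space.\<close>

abbreviation tvec :: "real \<Rightarrow> real \<Rightarrow> real \<Rightarrow> real \<Rightarrow> mat4" where
  "tvec u1 u2 v1 v2 \<equiv> so4_mat u1 u2 0 v1 v2 0"

lemma quad_grad_M3: "quad_grad \<alpha> \<beta> (M3 p q) = M3 (\<alpha>$3 * p) (\<beta>$3 * q)"
  by (simp add: M3_def quad_grad_so4_mat)

lemma M3_in_so4 [simp]: "M3 p q \<in> so4"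
  by (simp add: M3_def)

lemma lie_M3:
  "lie (M3 p q) (so4_mat c1 c2 c3 d1 d2 d3) =
     tvec (- (p * c2 + q * d2)) (p * c1 + q * d1) (- (q * c2 + p * d2)) (q * c1 + p * d1)"
  by (simp add: M3_def lie_so4_mat so4_mat_eq_iff)

lemma tvec_eq_lie_M3:
  assumes "p\<^sup>2 \<noteq> q\<^sup>2"
  defines "D \<equiv> p\<^sup>2 - q\<^sup>2"
  shows "tvec u1 u2 v1 v2 = lie (M3 p q) (so4_mat ((p * u2 - q * v2) / D) ((q * v1 - p * u1) / D) 0
     ((p * v2 - q * u2) / D) ((q * u1 - p * v1) / D) 0)"
proof -
  have D: "D \<noteq> 0" using assms by simp
  have e: "a * (x / D) + b * (y / D) = z" if "a * x + b * y = z * D" for a b x y z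
    using that D by (simp add: nonzero_divide_eq_eq flip: add_divide_distrib)
  have "p * ((q * v1 - p * u1) / D) + q * ((q * u1 - p * v1) / D) = - u1"
    "p * ((p * u2 - q * v2) / D) + q * ((p * v2 - q * u2) / D) = u2"
    "q * ((q * v1 - p * u1) / D) + p * ((q * u1 - p * v1) / D) = - v1"
    "q * ((p * u2 - q * v2) / D) + p * ((p * v2 - q * u2) / D) = v2"
    by (rule e; simp add: D_def power2_eq_square algebra_simps)+
  then show ?thesis by (simp only: lie_M3 minus_minus)
qed

lemma tangent_M3:
  assumes "p\<^sup>2 \<noteq> q\<^sup>2"
  shows "tangent (M3 p q) = {tvec u1 u2 v1 v2 | u1 u2 v1 v2. True}" (is "_ = ?T")
proof
  show "tangent (M3 p q) \<subseteq> ?T"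
    unfolding tangent_def by (safe, erule so4E) (auto simp: lie_M3)
  show "?T \<subseteq> tangent (M3 p q)"
    unfolding tangent_def by (safe, subst tvec_eq_lie_M3[OF assms]) (blast intro: so4_mat_in_so4)
qed

lemma tangent_M3E:
  assumes "p\<^sup>2 \<noteq> q\<^sup>2" "v \<in> tangent (M3 p q)"
  obtains u1 u2 v1 v2 where "v = tvec u1 u2 v1 v2"
  using assms(2) unfolding tangent_M3[OF assms(1)] by blast

lemma tvec_in_tangent [simp]: "p\<^sup>2 \<noteq> q\<^sup>2 \<Longrightarrow> tvec u1 u2 v1 v2 \<in> tangent (M3 p q)"
  unfolding tangent_M3 by blast

lemma tangent_eq_image:
  assumes "p\<^sup>2 \<noteq> q\<^sup>2"
  shows "tangent (M3 p q) = (\<lambda>u::real^4. tvec (u$1) (u$2) (u$3) (u$4)) ` UNIV"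
proof -
  have "tvec a b c d = (\<lambda>u::real^4. tvec (u$1) (u$2) (u$3) (u$4)) (vector [a, b, c, d])" for a b c d
    by simp
  then show ?thesis unfolding tangent_M3[OF assms] by blast
qed

lemma linear_tvec: "linear (\<lambda>u::real^4. tvec (u$1) (u$2) (u$3) (u$4))"
  by (rule linearI) (simp_all add: vec_eq_iff forall_4)

lemma subspace_tangent_M3: "p\<^sup>2 \<noteq> q\<^sup>2 \<Longrightarrow> subspace (tangent (M3 p q))"
  unfolding tangent_eq_image by (rule linear_subspace_image[OF linear_tvec subspace_UNIV])

lemma dim_tangent_M3: "p\<^sup>2 \<noteq> q\<^sup>2 \<Longrightarrow> dim (tangent (M3 p q)) \<le> 4"
  unfolding tangent_eq_image using dim_image_le[OF linear_tvec, of UNIV] by simp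

text \<open>The form pairs the plane of \<open>(x\<^sub>1, y\<^sub>1)\<close> with the plane of \<open>(x\<^sub>2, y\<^sub>2)\<close>, through the inverse of the
  matrix \<open>(p, q; q, p)\<close>; both planes are Lagrangian.\<close>

lemma omega_M3:
  assumes "p\<^sup>2 \<noteq> q\<^sup>2"
  defines "D \<equiv> p\<^sup>2 - q\<^sup>2"
  shows "omega (M3 p q) (tvec u1 u2 v1 v2) (tvec u1' u2' v1' v2') =
    (u1' * (p * u2 - q * v2) + v1' * (p * v2 - q * u2)
      - u1 * (p * u2' - q * v2') - v1 * (p * v2' - q * u2')) / D" (is "_ = ?r / D")
  unfolding omega_def
proof (rule the_equality)
  have D: "D \<noteq> 0" using assms by simp
  let ?U = "tvec u1 u2 v1 v2" and ?V = "tvec u1' u2' v1' v2'"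
  have val: "1/2 * trace (M3 p q ** lie X Y) = ?r / D"
    if XY: "X \<in> so4" "Y \<in> so4" and UV: "?U = lie (M3 p q) X" "?V = lie (M3 p q) Y" for X Y
  proof -
    obtain a1 a2 a3 b1 b2 b3 where X: "X = so4_mat a1 a2 a3 b1 b2 b3" using XY(1) by (rule so4E)
    obtain c1 c2 c3 d1 d2 d3 where Y: "Y = so4_mat c1 c2 c3 d1 d2 d3" using XY(2) by (rule so4E)
    have "u1 = - (p * a2 + q * b2)" "u2 = p * a1 + q * b1" "v1 = - (q * a2 + p * b2)" "v2 = q * a1 + p * b1"
      "u1' = - (p * c2 + q * d2)" "u2' = p * c1 + q * d1" "v1' = - (q * c2 + p * d2)" "v2' = q * c1 + p * d1"
      using UV unfolding X Y lie_M3 so4_mat_eq_iff by simp_all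
    moreover have "1/2 * trace (M3 p q ** lie X Y) =
      - (p * (a1 * c2 - a2 * c1 + (b1 * d2 - b2 * d1)) + q * (a1 * d2 - a2 * d1 + (b1 * c2 - b2 * c1)))"
      unfolding X Y M3_def lie_so4_mat trace_so4_mat by (simp add: algebra_simps)
    ultimately have "1/2 * trace (M3 p q ** lie X Y) * D = ?r"
      unfolding D_def by algebra
    then show ?thesis using D by (simp add: nonzero_eq_divide_eq)
  qed
  show "\<exists>X\<in>so4. \<exists>Y\<in>so4. ?U = lie (M3 p q) X \<and> ?V = lie (M3 p q) Y \<and>
      ?r / D = 1/2 * trace (M3 p q ** lie X Y)"
    using val tvec_eq_lie_M3[OF assms(1), of u1 u2 v1 v2] tvec_eq_lie_M3[OF assms(1), of u1' u2' v1' v2']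
    by (metis so4_mat_in_so4)
  show "r = ?r / D" if "\<exists>X\<in>so4. \<exists>Y\<in>so4. ?U = lie (M3 p q) X \<and> ?V = lie (M3 p q) Y \<and>
      r = 1/2 * trace (M3 p q ** lie X Y)" for r
    using that val by metis
qed

section \<open>Linearization of diagonal Hamiltonian fields\<close>

text \<open>The orthogonal projection of the space of all matrices onto the tangent space.\<close>

definition tangent_proj :: "mat4 \<Rightarrow> mat4" where
  "tangent_proj X = tvec ((X$3$2 - X$2$3) / 2) ((X$1$3 - X$3$1) / 2)
     ((X$1$4 - X$4$1) / 2) ((X$2$4 - X$4$2) / 2)"

text \<open>The derivative of \<open>M \<mapsto> [M, \<nabla>F(M)]\<close> at \<open>M3 p q\<close>, made an endomorphism of the tangent space in the
  representation by zero on the orthogonal complement.\<close>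

definition lin_op :: "real \<Rightarrow> real \<Rightarrow> real^3 \<Rightarrow> real^3 \<Rightarrow> mat4 \<Rightarrow>\<^sub>L mat4" where
  "lin_op p q \<alpha> \<beta> = Blinfun (\<lambda>X. lie (M3 p q) (quad_grad \<alpha> \<beta> (tangent_proj X))
     + lie (tangent_proj X) (quad_grad \<alpha> \<beta> (M3 p q)))"

lemma bounded_linear_tangent_proj: "bounded_linear tangent_proj"
proof -
  have "linear tangent_proj"
    by (rule linearI) (simp_all add: tangent_proj_def vec_eq_iff forall_4 field_simps)
  then show ?thesis by (simp add: linear_conv_bounded_linear)
qed

lemma lin_op_apply:
  "blinfun_apply (lin_op p q \<alpha> \<beta>) X = lie (M3 p q) (quad_grad \<alpha> \<beta> (tangent_proj X))
     + lie (tangent_proj X) (quad_grad \<alpha> \<beta> (M3 p q))"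
  unfolding lin_op_def
  by (subst bounded_linear_Blinfun_apply)
    (auto intro!: bounded_linear_add bounded_linear_tangent_proj
      bounded_linear_compose[OF bounded_linear_quad_grad]
      bounded_linear_compose[OF bounded_bilinear.bounded_linear_left[OF bounded_bilinear_lie]]
      bounded_linear_compose[OF bounded_bilinear.bounded_linear_right[OF bounded_bilinear_lie]])

lemma tangent_proj_tvec [simp]: "tangent_proj (tvec u1 u2 v1 v2) = tvec u1 u2 v1 v2"
  by (simp add: tangent_proj_def)

lemma lin_op_tvec:
  "blinfun_apply (lin_op p q \<alpha> \<beta>) (tvec u1 u2 v1 v2) =
    tvec (- (p * (\<alpha>$2 - \<alpha>$3) * u2 + q * (\<beta>$2 - \<beta>$3) * v2))
         (p * (\<alpha>$1 - \<alpha>$3) * u1 + q * (\<beta>$1 - \<beta>$3) * v1)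
         (- (q * (\<alpha>$2 - \<beta>$3) * u2 + p * (\<beta>$2 - \<alpha>$3) * v2))
         (q * (\<alpha>$1 - \<beta>$3) * u1 + p * (\<beta>$1 - \<alpha>$3) * v1)"
  by (simp add: lin_op_apply quad_grad_so4_mat lie_M3 quad_grad_M3)
    (simp add: M3_def lie_so4_mat vec_eq_iff forall_4 algebra_simps)

lemma lin_op_in_End_on:
  assumes "p\<^sup>2 \<noteq> q\<^sup>2"
  shows "lin_op p q \<alpha> \<beta> \<in> End_on (tangent (M3 p q))"
proof -
  have "blinfun_apply (lin_op p q \<alpha> \<beta>) X \<in> tangent (M3 p q)" for X
  proof -
    have "blinfun_apply (lin_op p q \<alpha> \<beta>) X = blinfun_apply (lin_op p q \<alpha> \<beta>) (tangent_proj X)"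
      unfolding lin_op_apply by (simp add: tangent_proj_def)
    then show ?thesis using assms by (simp add: tangent_proj_def lin_op_tvec)
  qed
  moreover have "blinfun_apply (lin_op p q \<alpha> \<beta>) X = 0" if "X \<in> orthogonal_comp (tangent (M3 p q))" for X
  proof -
    have "inner (tvec u1 u2 v1 v2) X = 0" for u1 u2 v1 v2
      using that assms by (simp add: orthogonal_comp_def orthogonal_def)
    from this[of 1 0 0 0] this[of 0 1 0 0] this[of 0 0 1 0] this[of 0 0 0 1]
    have "tangent_proj X = tvec 0 0 0 0"
      by (simp add: tangent_proj_def so4_mat_eq_iff inner_vec_def sum_4)
    then have "blinfun_apply (lin_op p q \<alpha> \<beta>) X = blinfun_apply (lin_op p q \<alpha> \<beta>) (tvec 0 0 0 0)"
      unfolding lin_op_apply by simp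
    also have "tvec 0 0 0 0 = 0" by (simp add: vec_eq_iff forall_4)
    finally show ?thesis by simp
  qed
  ultimately show ?thesis by (simp add: End_on_def)
qed

lemma linearization_quad:
  assumes "p\<^sup>2 \<noteq> q\<^sup>2"
  shows "linearization (ham_vf (quad \<alpha> \<beta>)) (M3 p q) = lin_op p q \<alpha> \<beta>"
  unfolding linearization_def
proof (rule the_equality)
  let ?T = "tangent (M3 p q)" and ?X = "ham_vf (quad \<alpha> \<beta>)"
  let ?D = "\<lambda>X. lie (M3 p q) (quad_grad \<alpha> \<beta> X) + lie X (quad_grad \<alpha> \<beta> (M3 p q))"
  have D: "(?X has_derivative ?D) (at (M3 p q) within so4)"
    by (simp add: ham_vf_quad_has_derivative)
  have LD: "blinfun_apply (lin_op p q \<alpha> \<beta>) v = ?D v" if "v \<in> ?T" for v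
    using that by (elim tangent_M3E[OF assms(1)]) (simp add: lin_op_apply)
  show "lin_op p q \<alpha> \<beta> \<in> End_on ?T \<and> (\<exists>D. (?X has_derivative D) (at (M3 p q) within so4) \<and>
      (\<forall>v\<in>?T. blinfun_apply (lin_op p q \<alpha> \<beta>) v = D v))"
    using lin_op_in_End_on[OF assms(1)] D LD by blast
  fix L assume "L \<in> End_on ?T \<and> (\<exists>D. (?X has_derivative D) (at (M3 p q) within so4) \<and>
      (\<forall>v\<in>?T. blinfun_apply L v = D v))"
  then obtain E where L: "L \<in> End_on ?T" "(?X has_derivative E) (at (M3 p q) within so4)"
      "\<And>v. v \<in> ?T \<Longrightarrow> blinfun_apply L v = E v" by blast
  show "L = lin_op p q \<alpha> \<beta>"
  proof (rule End_on_eqI[OF subspace_tangent_M3[OF assms(1)] L(1) lin_op_in_End_on[OF assms(1)]])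
    fix v assume v: "v \<in> ?T"
    then have "v \<in> so4" by (elim tangent_M3E[OF assms(1)]) simp
    then have "E v = ?D v"
      using has_derivative_within_subspace_unique[OF subspace_so4 _ _ L(2) D] by simp
    then show "blinfun_apply L v = blinfun_apply (lin_op p q \<alpha> \<beta>) v"
      using L(3) LD v by simp
  qed
qed

lemma lin_op_in_symp_alg:
  assumes "p\<^sup>2 \<noteq> q\<^sup>2"
  shows "lin_op p q \<alpha> \<beta> \<in> symp_alg (tangent (M3 p q)) (omega (M3 p q))"
proof -
  have "omega (M3 p q) (blinfun_apply (lin_op p q \<alpha> \<beta>) u) v
     + omega (M3 p q) u (blinfun_apply (lin_op p q \<alpha> \<beta>) v) = 0"
    if uv: "u \<in> tangent (M3 p q)" "v \<in> tangent (M3 p q)" for u v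
  proof -
    obtain u1 u2 v1 v2 where u: "u = tvec u1 u2 v1 v2" using uv(1) by (rule tangent_M3E[OF assms])
    obtain u1' u2' v1' v2' where v: "v = tvec u1' u2' v1' v2'" using uv(2) by (rule tangent_M3E[OF assms])
    show ?thesis
      unfolding u v lin_op_tvec omega_M3[OF assms] add_divide_distrib[symmetric]
      by (simp add: algebra_simps)
  qed
  then show ?thesis using lin_op_in_End_on[OF assms] by (simp add: symp_alg_def)
qed

text \<open>A constant \<open>c\<close> added to all coefficients is a multiple of the Casimir \<open>C1\<close> and drops out.\<close>

lemma lin_op_lincomb:
  assumes "p\<^sup>2 \<noteq> q\<^sup>2"
    and "\<And>i. \<alpha> $ i = c + s * \<alpha>' $ i + t * \<alpha>'' $ i" "\<And>i. \<beta> $ i = c + s * \<beta>' $ i + t * \<beta>'' $ i"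
  shows "lin_op p q \<alpha> \<beta> = s *\<^sub>R lin_op p q \<alpha>' \<beta>' + t *\<^sub>R lin_op p q \<alpha>'' \<beta>''"
proof (rule End_on_eqI[OF subspace_tangent_M3[OF assms(1)] lin_op_in_End_on[OF assms(1)]])
  show "s *\<^sub>R lin_op p q \<alpha>' \<beta>' + t *\<^sub>R lin_op p q \<alpha>'' \<beta>'' \<in> End_on (tangent (M3 p q))"
    using lin_op_in_End_on[OF assms(1)] subspace_tangent_M3[OF assms(1)]
    by (intro subspace_add subspace_scale subspace_End_on)
  fix v assume "v \<in> tangent (M3 p q)"
  then obtain u1 u2 v1 v2 where v: "v = tvec u1 u2 v1 v2" by (rule tangent_M3E[OF assms(1)])
  show "blinfun_apply (lin_op p q \<alpha> \<beta>) v =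
      blinfun_apply (s *\<^sub>R lin_op p q \<alpha>' \<beta>' + t *\<^sub>R lin_op p q \<alpha>'' \<beta>'') v"
    unfolding v blinfun.add_left blinfun.scaleR_left lin_op_tvec
    by (simp add: vec_eq_iff forall_4 assms(2,3) algebra_simps)
qed

lemma commutator_eq_0I:
  assumes "subspace V" "L \<in> End_on V" "K \<in> End_on V"
    and "\<And>v. v \<in> V \<Longrightarrow> blinfun_apply L (blinfun_apply K v) = blinfun_apply K (blinfun_apply L v)"
  shows "commutator L K = 0"
proof (rule End_on_eqI[OF assms(1)])
  show "commutator L K \<in> End_on V"
    using assms by (auto simp: End_on_def commutator_apply subspace_diff)
  show "0 \<in> End_on V" by (rule subspace_0[OF subspace_End_on[OF assms(1)]])
qed (simp add: commutator_apply assms(4))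

text \<open>A map pulling the form back to a non-degenerate one is injective; a dimension count does the rest.\<close>

lemma symplectic_frameI:
  fixes \<phi> :: "real^4 \<Rightarrow> 'a::euclidean_space"
  assumes "linear \<phi>" "\<And>u. \<phi> u \<in> V" "subspace V" "dim V \<le> 4"
    and w: "\<And>u v. w (\<phi> u) (\<phi> v) = std_symp u v"
  shows "symplectic_frame V w \<phi>"
proof (rule symplectic_frame.intro)
  have "inj \<phi>"
    unfolding linear_inj_iff_eq_0[OF assms(1)]
  proof safe
    fix u assume "\<phi> u = 0"
    then have "std_symp u v = std_symp 0 v" for v
      using w[of u v] w[of 0 v] linear_0[OF assms(1)] by simp
    from this[of "axis 1 1"] this[of "axis 2 1"] this[of "axis 3 1"] this[of "axis 4 1"]
    show "u = 0" by (simp add: std_symp_def axis_def vec_eq_iff forall_4)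
  qed
  moreover have "range \<phi> = V"
  proof (rule subspace_dim_equal)
    show "dim V \<le> dim (range \<phi>)"
      using assms(4) dim_image_eq[OF assms(1), of UNIV] \<open>inj \<phi>\<close> by simp
  qed (use assms in \<open>auto intro: linear_subspace_image\<close>)
  ultimately show "bij_betw \<phi> UNIV V" by (simp add: bij_betw_def)
qed (use assms in auto)

section \<open>Symplectic normal form of a definite Hamiltonian\<close>

lemma symmetric_2x2_eigenbasis:
  fixes m n k :: real
  obtains c s \<theta>1 \<theta>2 where "c\<^sup>2 + s\<^sup>2 = 1" "m * c + n * s = \<theta>1 * c" "n * c + k * s = \<theta>1 * s"
    "n * c - m * s = - \<theta>2 * s" "k * c - n * s = \<theta>2 * c"
proof -
  \<comment> \<open>The rotation that diagonalizes the form has half the polar angle of \<open>(m - k, 2 n)\<close>.\<close>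
  obtain r a where ra: "m - k = r * cos a" "2 * n = r * sin a" using polar_Ex by blast
  define c s where "c = cos (a / 2)" and "s = sin (a / 2)"
  have cs: "c\<^sup>2 + s\<^sup>2 = 1" by (simp add: c_def s_def)
  have "cos a = c\<^sup>2 - s\<^sup>2" "sin a = 2 * s * c"
    using cos_double[of "a/2"] sin_double[of "a/2"] by (simp_all add: c_def s_def)
  then have key: "(m - k) * (s * c) = n * (c\<^sup>2 - s\<^sup>2)"
    using ra by algebra
  show ?thesis
  proof (rule that[OF cs])
    show "m * c + n * s = (m * c\<^sup>2 + 2 * n * c * s + k * s\<^sup>2) * c" using cs key by algebra
    show "n * c + k * s = (m * c\<^sup>2 + 2 * n * c * s + k * s\<^sup>2) * s" using cs key by algebra
    show "n * c - m * s = - (m * s\<^sup>2 - 2 * n * c * s + k * c\<^sup>2) * s" using cs key by algebra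
    show "k * c - n * s = (m * s\<^sup>2 - 2 * n * c * s + k * c\<^sup>2) * c" using cs key by algebra
  qed
qed

text \<open>Write \<open>N\<close> for the matrix \<open>(p, q; q, p)\<close> and \<open>S\<^sub>1 = diag(a1, b1)\<close>, \<open>S\<^sub>2 = diag(a2, b2)\<close>.  The vectors
  \<open>(r\<^sub>i, s\<^sub>i)\<close> are eigenvectors of \<open>N S\<^sub>2 N S\<^sub>1\<close> with eigenvalues \<open>\<omega>\<^sub>i\<^sup>2\<close>, orthogonal for the form \<open>S\<^sub>1\<close>,
  which takes the value \<open>\<omega>\<^sub>i\<close> on them.  They come from the symmetric matrix \<open>S\<^sub>1\<^sup>1\<^sup>/\<^sup>2 N S\<^sub>2 N S\<^sub>1\<^sup>1\<^sup>/\<^sup>2\<close>, whose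
  eigenvalues are positive: its diagonal is nonnegative and its determinant is
  \<open>a1 b1 a2 b2 (p\<^sup>2 - q\<^sup>2)\<^sup>2\<close>.  It is a scalar matrix only if \<open>p q = 0\<close>, and then
  the inequalities \<open>ne\<close> exclude it: one of them for \<open>q = 0\<close>, the other for \<open>p = 0\<close>.\<close>

lemma williamson_2x2:
  fixes p q a1 a2 b1 b2 :: real
  assumes pq: "p\<^sup>2 \<noteq> q\<^sup>2" and pos: "a1 > 0" "a2 > 0" "b1 > 0" "b2 > 0"
    and ne: "a1 * a2 \<noteq> b1 * b2" "a1 * b2 \<noteq> b1 * a2"
  obtains r1 s1 r2 s2 \<omega>1 \<omega>2 where "\<omega>1 > 0" "\<omega>2 > 0" "\<omega>1\<^sup>2 \<noteq> \<omega>2\<^sup>2"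
    "a1 * r1\<^sup>2 + b1 * s1\<^sup>2 = \<omega>1" "a1 * r2\<^sup>2 + b1 * s2\<^sup>2 = \<omega>2" "a1 * r1 * r2 + b1 * s1 * s2 = 0"
    "a1 * (p\<^sup>2 * a2 + q\<^sup>2 * b2) * r1 + b1 * (p * q * (a2 + b2)) * s1 = \<omega>1\<^sup>2 * r1"
    "a1 * (p * q * (a2 + b2)) * r1 + b1 * (q\<^sup>2 * a2 + p\<^sup>2 * b2) * s1 = \<omega>1\<^sup>2 * s1"
    "a1 * (p\<^sup>2 * a2 + q\<^sup>2 * b2) * r2 + b1 * (p * q * (a2 + b2)) * s2 = \<omega>2\<^sup>2 * r2"
    "a1 * (p * q * (a2 + b2)) * r2 + b1 * (q\<^sup>2 * a2 + p\<^sup>2 * b2) * s2 = \<omega>2\<^sup>2 * s2"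
proof -
  define \<sigma> \<tau> where "\<sigma> = sqrt a1" and "\<tau> = sqrt b1"
  have st: "\<sigma> > 0" "\<tau> > 0" "\<sigma>\<^sup>2 = a1" "\<tau>\<^sup>2 = b1" using pos by (simp_all add: \<sigma>_def \<tau>_def)
  define e h f where "e = p\<^sup>2 * a2 + q\<^sup>2 * b2" and "h = p * q * (a2 + b2)" and "f = q\<^sup>2 * a2 + p\<^sup>2 * b2"
  \<comment> \<open>\<open>(e, h; h, f)\<close> is \<open>N S\<^sub>2 N\<close>, and \<open>(m, n; n, k)\<close> its symmetrized product with \<open>S\<^sub>1\<close>.\<close>
  define m n k where "m = a1 * e" and "n = \<sigma> * \<tau> * h" and "k = b1 * f"
  obtain c s \<theta>1 \<theta>2 where ev: "c\<^sup>2 + s\<^sup>2 = 1" "m * c + n * s = \<theta>1 * c" "n * c + k * s = \<theta>1 * s"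
    "n * c - m * s = - \<theta>2 * s" "k * c - n * s = \<theta>2 * c"
    using symmetric_2x2_eigenbasis[of m n k] by blast
  have det: "m * k - n\<^sup>2 = a1 * b1 * a2 * b2 * (p\<^sup>2 - q\<^sup>2)\<^sup>2"
    unfolding m_def n_def k_def e_def h_def f_def power_mult_distrib st by algebra
  have "m * k - n\<^sup>2 > 0"
    unfolding det using pos pq by (intro mult_pos_pos) simp_all
  moreover have tr: "\<theta>1 + \<theta>2 = m + k" "\<theta>1 * \<theta>2 = m * k - n\<^sup>2" using ev by algebra+
  moreover have "m \<ge> 0" "k \<ge> 0" using pos by (simp_all add: m_def k_def e_def f_def)
  ultimately have th: "\<theta>1 > 0" "\<theta>2 > 0"
    by (smt (verit) mult_nonneg_nonpos mult_nonneg_nonpos2 zero_less_mult_iff)+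
  have thne: "\<theta>1 \<noteq> \<theta>2"
  proof
    assume eq: "\<theta>1 = \<theta>2"
    have "m - \<theta>1 = 0" "n = 0" "k - \<theta>1 = 0" using ev[folded eq] by algebra+
    then have "m = k" by simp
    have "h = 0" using \<open>n = 0\<close> st by (simp add: n_def)
    then have "p = 0 \<or> q = 0" using pos by (simp add: h_def)
    then show False using \<open>m = k\<close> ne pq by (auto simp: m_def k_def e_def f_def algebra_simps)
  qed
  define \<omega>1 \<omega>2 where "\<omega>1 = sqrt \<theta>1" and "\<omega>2 = sqrt \<theta>2"
  have om: "\<omega>1 > 0" "\<omega>2 > 0" "\<omega>1\<^sup>2 = \<theta>1" "\<omega>2\<^sup>2 = \<theta>2" using th by (simp_all add: \<omega>1_def \<omega>2_def)
  define k1 k2 where "k1 = sqrt \<omega>1" and "k2 = sqrt \<omega>2"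
  have kk: "k1\<^sup>2 = \<omega>1" "k2\<^sup>2 = \<omega>2" using om by (simp_all add: k1_def k2_def)
  define r1 s1 r2 s2 where "r1 = k1 * c / \<sigma>" and "s1 = k1 * s / \<tau>" and "r2 = - (k2 * s / \<sigma>)" and "s2 = k2 * c / \<tau>"
  have rs: "\<sigma> * r1 = k1 * c" "\<tau> * s1 = k1 * s" "\<sigma> * r2 = - (k2 * s)" "\<tau> * s2 = k2 * c"
    using st by (simp_all add: r1_def s1_def r2_def s2_def)
  have cancel: "x = y" if "z * x = z * y" "z > 0" for x y z :: real using that by simp
  show ?thesis
  proof (rule that[of \<omega>1 \<omega>2 r1 s1 r2 s2, folded e_def h_def f_def])
    show "\<omega>1 > 0" "\<omega>2 > 0" "\<omega>1\<^sup>2 \<noteq> \<omega>2\<^sup>2" using om thne by simp_all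
    have quad: "a1 * x * x' + b1 * y * y' = (\<sigma> * x) * (\<sigma> * x') + (\<tau> * y) * (\<tau> * y')" for x x' y y'
      unfolding st(3,4)[symmetric] by (simp add: power2_eq_square)
    have "c * c + s * s = 1" using ev(1) by (simp add: power2_eq_square)
    then have "k1 * c * (k1 * c) + k1 * s * (k1 * s) = k1 * k1" "k2 * s * (k2 * s) + k2 * c * (k2 * c) = k2 * k2"
      by algebra+
    then show "a1 * r1\<^sup>2 + b1 * s1\<^sup>2 = \<omega>1" "a1 * r2\<^sup>2 + b1 * s2\<^sup>2 = \<omega>2" "a1 * r1 * r2 + b1 * s1 * s2 = 0"
      using quad[of r1 r1 s1 s1] quad[of r2 r2 s2 s2] quad[of r1 r2 s1 s2] kk
      by (simp_all add: rs power2_eq_square mult.assoc)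
    have row: "\<sigma> * (a1 * e * x + b1 * h * y) = m * (\<sigma> * x) + n * (\<tau> * y)"
      "\<tau> * (a1 * h * x + b1 * f * y) = n * (\<sigma> * x) + k * (\<tau> * y)" for x y
      unfolding m_def n_def k_def st(3,4)[symmetric] by (simp_all add: power2_eq_square algebra_simps)
    have "\<sigma> * (a1 * e * r1 + b1 * h * s1) = k1 * (m * c + n * s)"
      unfolding row(1) rs by (simp add: algebra_simps)
    also have "\<dots> = \<sigma> * (\<omega>1\<^sup>2 * r1)"
      unfolding ev(2) om(3,4) mult.left_commute[of _ "\<theta>1"] mult.left_commute[of _ "\<theta>2"] rs by simp
    finally show "a1 * e * r1 + b1 * h * s1 = \<omega>1\<^sup>2 * r1"
      using st(1,2) by simp
    have "\<tau> * (a1 * h * r1 + b1 * f * s1) = k1 * (n * c + k * s)"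
      unfolding row(2) rs by (simp add: algebra_simps)
    also have "\<dots> = \<tau> * (\<omega>1\<^sup>2 * s1)"
      unfolding ev(3) om(3,4) mult.left_commute[of _ "\<theta>1"] mult.left_commute[of _ "\<theta>2"] rs by simp
    finally show "a1 * h * r1 + b1 * f * s1 = \<omega>1\<^sup>2 * s1"
      using st(1,2) by simp
    have "\<sigma> * (a1 * e * r2 + b1 * h * s2) = k2 * (n * c - m * s)"
      unfolding row(1) rs by (simp add: algebra_simps)
    also have "\<dots> = \<sigma> * (\<omega>2\<^sup>2 * r2)"
      unfolding ev(4) om(3,4) mult.left_commute[of _ "\<theta>1"] mult.left_commute[of _ "\<theta>2"] rs by simp
    finally show "a1 * e * r2 + b1 * h * s2 = \<omega>2\<^sup>2 * r2"
      using st(1,2) by simp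
    have "\<tau> * (a1 * h * r2 + b1 * f * s2) = k2 * (k * c - n * s)"
      unfolding row(2) rs by (simp add: algebra_simps)
    also have "\<dots> = \<tau> * (\<omega>2\<^sup>2 * s2)"
      unfolding ev(5) om(3,4) mult.left_commute[of _ "\<theta>1"] mult.left_commute[of _ "\<theta>2"] rs by simp
    finally show "a1 * h * r2 + b1 * f * s2 = \<omega>2\<^sup>2 * s2"
      using st(1,2) by simp
  qed
qed

text \<open>In the coordinates \<open>\<delta>\<^sub>1 = (x\<^sub>1, y\<^sub>1)\<close>, \<open>\<delta>\<^sub>2 = (x\<^sub>2, y\<^sub>2)\<close> the linearized flow is
  \<open>\<delta>\<^sub>1' = - N S\<^sub>2 \<delta>\<^sub>2\<close>, \<open>\<delta>\<^sub>2' = N S\<^sub>1 \<delta>\<^sub>1\<close>.  With the eigenvectors \<open>f\<^sub>i\<close> of \<open>N S\<^sub>2 N S\<^sub>1\<close> in the first plane and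
  \<open>g\<^sub>i = - N S\<^sub>1 f\<^sub>i / \<omega>\<^sub>i\<close> in the second, the map sends \<open>f\<^sub>i\<close> to \<open>- \<omega>\<^sub>i g\<^sub>i\<close> and \<open>g\<^sub>i\<close> to \<open>\<omega>\<^sub>i f\<^sub>i\<close>, and the
  normalization of the \<open>f\<^sub>i\<close> is exactly what makes \<open>(f\<^sub>1, f\<^sub>2, g\<^sub>1, g\<^sub>2)\<close> a symplectic basis.\<close>

lemma definite_center_center_frame:
  assumes pq: "p\<^sup>2 \<noteq> q\<^sup>2" and pos: "\<alpha>$1 > 0" "\<alpha>$2 > 0" "\<beta>$1 > 0" "\<beta>$2 > 0"
    and zero: "\<alpha>$3 = 0" "\<beta>$3 = 0"
    and ne: "\<alpha>$1 * \<alpha>$2 \<noteq> \<beta>$1 * \<beta>$2" "\<alpha>$1 * \<beta>$2 \<noteq> \<beta>$1 * \<alpha>$2"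
  obtains \<phi> A B where "symplectic_frame (tangent (M3 p q)) (omega (M3 p q)) \<phi>"
    "A \<noteq> 0" "B \<noteq> 0" "A\<^sup>2 \<noteq> B\<^sup>2"
    "\<And>u. blinfun_apply (lin_op p q \<alpha> \<beta>) (\<phi> u) = \<phi> (cc_matrix A B *v u)"
proof -
  define a1 a2 b1 b2 where "a1 = \<alpha>$1" and "a2 = \<alpha>$2" and "b1 = \<beta>$1" and "b2 = \<beta>$2"
  note ab = a1_def[symmetric] a2_def[symmetric] b1_def[symmetric] b2_def[symmetric]
  obtain r1 s1 r2 s2 \<omega>1 \<omega>2 where om: "\<omega>1 > 0" "\<omega>2 > 0" "\<omega>1\<^sup>2 \<noteq> \<omega>2\<^sup>2"
    and nrm: "a1 * r1\<^sup>2 + b1 * s1\<^sup>2 = \<omega>1" "a1 * r2\<^sup>2 + b1 * s2\<^sup>2 = \<omega>2" "a1 * r1 * r2 + b1 * s1 * s2 = 0"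
    and ev: "a1 * (p\<^sup>2 * a2 + q\<^sup>2 * b2) * r1 + b1 * (p * q * (a2 + b2)) * s1 = \<omega>1\<^sup>2 * r1"
    "a1 * (p * q * (a2 + b2)) * r1 + b1 * (q\<^sup>2 * a2 + p\<^sup>2 * b2) * s1 = \<omega>1\<^sup>2 * s1"
    "a1 * (p\<^sup>2 * a2 + q\<^sup>2 * b2) * r2 + b1 * (p * q * (a2 + b2)) * s2 = \<omega>2\<^sup>2 * r2"
    "a1 * (p * q * (a2 + b2)) * r2 + b1 * (q\<^sup>2 * a2 + p\<^sup>2 * b2) * s2 = \<omega>2\<^sup>2 * s2"
    by (rule williamson_2x2[OF pq pos ne, unfolded ab])
  define g1 h1 g2 h2 where "g1 = - (p * a1 * r1 + q * b1 * s1) / \<omega>1" and "h1 = - (q * a1 * r1 + p * b1 * s1) / \<omega>1"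
    and "g2 = - (p * a1 * r2 + q * b1 * s2) / \<omega>2" and "h2 = - (q * a1 * r2 + p * b1 * s2) / \<omega>2"
  have gh: "\<omega>1 * g1 = - (p * a1 * r1 + q * b1 * s1)" "\<omega>1 * h1 = - (q * a1 * r1 + p * b1 * s1)"
    "\<omega>2 * g2 = - (p * a1 * r2 + q * b1 * s2)" "\<omega>2 * h2 = - (q * a1 * r2 + p * b1 * s2)"
    using om by (simp_all add: g1_def h1_def g2_def h2_def)
  have return: "- (p * a2 * g + q * b2 * h) = \<omega> * r" "- (q * a2 * g + p * b2 * h) = \<omega> * s"
    if \<omega>: "\<omega> > 0" and gh: "\<omega> * g = - (p * a1 * r + q * b1 * s)" "\<omega> * h = - (q * a1 * r + p * b1 * s)"
      and ev: "a1 * (p\<^sup>2 * a2 + q\<^sup>2 * b2) * r + b1 * (p * q * (a2 + b2)) * s = \<omega>\<^sup>2 * r"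
      "a1 * (p * q * (a2 + b2)) * r + b1 * (q\<^sup>2 * a2 + p\<^sup>2 * b2) * s = \<omega>\<^sup>2 * s"
    for \<omega> g h r s
  proof -
    have "\<omega> * (- (p * a2 * g + q * b2 * h)) = - (p * a2 * (\<omega> * g) + q * b2 * (\<omega> * h))"
      by (simp add: algebra_simps)
    also have "\<dots> = \<omega> * (\<omega> * r)"
      unfolding gh using ev by (simp add: power2_eq_square algebra_simps)
    finally show "- (p * a2 * g + q * b2 * h) = \<omega> * r"
      using \<omega> by simp
    have "\<omega> * (- (q * a2 * g + p * b2 * h)) = - (q * a2 * (\<omega> * g) + p * b2 * (\<omega> * h))"
      by (simp add: algebra_simps)
    also have "\<dots> = \<omega> * (\<omega> * s)"
      unfolding gh using ev by (simp add: power2_eq_square algebra_simps)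
    finally show "- (q * a2 * g + p * b2 * h) = \<omega> * s"
      using \<omega> by simp
  qed
  note L = return[OF om(1) gh(1,2) ev(1,2)] and L' = return[OF om(2) gh(3,4) ev(3,4)]
  define D where "D = p\<^sup>2 - q\<^sup>2"
  have D: "D \<noteq> 0" using pq by (simp add: D_def)
  have pairing: "r * (p * g - q * h) + s * (p * h - q * g) = - D * x"
    if \<omega>: "\<omega> > 0" and gh: "\<omega> * g = - (p * a1 * r' + q * b1 * s')" "\<omega> * h = - (q * a1 * r' + p * b1 * s')"
      and x: "a1 * r * r' + b1 * s * s' = \<omega> * x" for \<omega> g h r s r' s' x
  proof -
    have "\<omega> * (r * (p * g - q * h) + s * (p * h - q * g)) =
        r * (p * (\<omega> * g) - q * (\<omega> * h)) + s * (p * (\<omega> * h) - q * (\<omega> * g))"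
      by (simp add: algebra_simps)
    also have "\<dots> = - D * (a1 * r * r' + b1 * s * s')"
      unfolding gh D_def by (simp add: power2_eq_square algebra_simps)
    also have "\<dots> = \<omega> * (- D * x)" unfolding x by simp
    finally show ?thesis using \<omega> unfolding mult_cancel_left by simp
  qed
  have nrm': "a1 * r1 * r1 + b1 * s1 * s1 = \<omega>1 * 1" "a1 * r2 * r2 + b1 * s2 * s2 = \<omega>2 * 1"
    "a1 * r2 * r1 + b1 * s2 * s1 = \<omega>1 * 0" "a1 * r1 * r2 + b1 * s1 * s2 = \<omega>2 * 0"
    using nrm by (simp_all add: power2_eq_square mult_ac)
  note W = pairing[OF om(1) gh(1,2) nrm'(1)] pairing[OF om(1) gh(1,2) nrm'(3)]
    pairing[OF om(2) gh(3,4) nrm'(4)] pairing[OF om(2) gh(3,4) nrm'(2)]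
  define \<phi> :: "real^4 \<Rightarrow> mat4" where
    "\<phi> u = tvec (u$1 * r1 + u$2 * r2) (u$3 * g1 + u$4 * g2) (u$1 * s1 + u$2 * s2) (u$3 * h1 + u$4 * h2)" for u
  have "symplectic_frame (tangent (M3 p q)) (omega (M3 p q)) \<phi>"
  proof (rule symplectic_frameI)
    show "linear \<phi>"
      by (rule linearI) (simp_all add: \<phi>_def vec_eq_iff forall_4 algebra_simps)
    show "\<phi> u \<in> tangent (M3 p q)" for u using pq by (simp add: \<phi>_def)
    fix u v :: "real^4"
    have "(v$1 * r1 + v$2 * r2) * (p * (u$3 * g1 + u$4 * g2) - q * (u$3 * h1 + u$4 * h2)) +
      (v$1 * s1 + v$2 * s2) * (p * (u$3 * h1 + u$4 * h2) - q * (u$3 * g1 + u$4 * g2)) =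
        - (v$1 * u$3 + v$2 * u$4) * D" for u v :: "real^4"
      using W by algebra
    from this[of v u] this[of u v] have
      "(v$1 * r1 + v$2 * r2) * (p * (u$3 * g1 + u$4 * g2) - q * (u$3 * h1 + u$4 * h2)) +
      (v$1 * s1 + v$2 * s2) * (p * (u$3 * h1 + u$4 * h2) - q * (u$3 * g1 + u$4 * g2)) -
      (u$1 * r1 + u$2 * r2) * (p * (v$3 * g1 + v$4 * g2) - q * (v$3 * h1 + v$4 * h2)) -
      (u$1 * s1 + u$2 * s2) * (p * (v$3 * h1 + v$4 * h2) - q * (v$3 * g1 + v$4 * g2)) = std_symp u v * D"
      by (simp add: std_symp_def algebra_simps)
    then show "omega (M3 p q) (\<phi> u) (\<phi> v) = std_symp u v"
      unfolding \<phi>_def omega_M3[OF pq] D_def[symmetric] using D by simp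
  qed (use pq in \<open>simp_all add: subspace_tangent_M3 dim_tangent_M3\<close>)
  moreover have "blinfun_apply (lin_op p q \<alpha> \<beta>) (\<phi> u) = \<phi> (cc_matrix (- \<omega>1) (- \<omega>2) *v u)" for u
    unfolding \<phi>_def lin_op_tvec zero ab cc_matrix_mult_vec so4_mat_eq_iff vector_4 diff_zero
  proof (intro conjI refl)
    show "- (p * a2 * (u$3 * g1 + u$4 * g2) + q * b2 * (u$3 * h1 + u$4 * h2)) =
        - (- \<omega>1) * u$3 * r1 + - (- \<omega>2) * u$4 * r2"
      using L(1) L'(1) by algebra
    show "- (q * a2 * (u$3 * g1 + u$4 * g2) + p * b2 * (u$3 * h1 + u$4 * h2)) =
        - (- \<omega>1) * u$3 * s1 + - (- \<omega>2) * u$4 * s2"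
      using L(2) L'(2) by algebra
    show "p * a1 * (u$1 * r1 + u$2 * r2) + q * b1 * (u$1 * s1 + u$2 * s2) = - \<omega>1 * u$1 * g1 + - \<omega>2 * u$2 * g2"
      using gh(1,3) by algebra
    show "q * a1 * (u$1 * r1 + u$2 * r2) + p * b1 * (u$1 * s1 + u$2 * s2) = - \<omega>1 * u$1 * h1 + - \<omega>2 * u$2 * h2"
      using gh(2,4) by algebra
  qed
  ultimately show ?thesis
    using that[of \<phi> "- \<omega>1" "- \<omega>2"] om by simp
qed

section \<open>The Manakov integrals\<close>

definition ham_x :: "real^4 \<Rightarrow> real^3" where
  "ham_x l = vector [1 / (l$2 + l$3), 1 / (l$1 + l$3), 1 / (l$1 + l$2)]"
definition ham_y :: "real^4 \<Rightarrow> real^3" where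
  "ham_y l = vector [1 / (l$1 + l$4), 1 / (l$2 + l$4), 1 / (l$3 + l$4)]"
definition int_x :: "real^4 \<Rightarrow> real^3" where
  "int_x l = vector [2 * ((l$2)\<^sup>2 + (l$3)\<^sup>2), 2 * ((l$1)\<^sup>2 + (l$3)\<^sup>2), 2 * ((l$1)\<^sup>2 + (l$2)\<^sup>2)]"
definition int_y :: "real^4 \<Rightarrow> real^3" where
  "int_y l = vector [2 * ((l$1)\<^sup>2 + (l$4)\<^sup>2), 2 * ((l$2)\<^sup>2 + (l$4)\<^sup>2), 2 * ((l$3)\<^sup>2 + (l$4)\<^sup>2)]"

text \<open>The Manakov coefficients of \<open>b = (0, 0, -1, -1)\<close>.  This integral is positive definite transversally
  to \<open>t3\<close>.\<close>

definition trans_x :: "real^4 \<Rightarrow> real^3" where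
  "trans_x l = vector [1 / ((l$2)\<^sup>2 - (l$3)\<^sup>2), 1 / ((l$1)\<^sup>2 - (l$3)\<^sup>2), 0]"
definition trans_y :: "real^4 \<Rightarrow> real^3" where
  "trans_y l = vector [1 / ((l$1)\<^sup>2 - (l$4)\<^sup>2), 1 / ((l$2)\<^sup>2 - (l$4)\<^sup>2), 0]"

text \<open>The Manakov integral of \<open>b = (0, 0, 0, -1)\<close>: its coefficients are \<open>0\<close> in \<open>x\<close> and these in \<open>y\<close>.\<close>

definition fourth_y :: "real^4 \<Rightarrow> real^3" where
  "fourth_y l = vector [1 / ((l$1)\<^sup>2 - (l$4)\<^sup>2), 1 / ((l$2)\<^sup>2 - (l$4)\<^sup>2), 1 / ((l$3)\<^sup>2 - (l$4)\<^sup>2)]"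

lemma ham_H_quad: "ham_H l = quad (ham_x l) (ham_y l)"
  by (simp add: fun_eq_iff ham_H_def quad_def ham_x_def ham_y_def)

lemma int_I_quad: "int_I l = quad (int_x l) (int_y l)"
  by (rule ext, simp add: int_I_def quad_def int_x_def int_y_def) (simp add: algebra_simps)

text \<open>The Poisson bracket of two diagonal quadratic functions is a cubic form in which only the four
  monomials \<open>x\<^sub>1 x\<^sub>2 x\<^sub>3\<close>, \<open>x\<^sub>1 y\<^sub>2 y\<^sub>3\<close>, \<open>y\<^sub>1 x\<^sub>2 y\<^sub>3\<close>, \<open>y\<^sub>1 y\<^sub>2 x\<^sub>3\<close> occur, one for each triple of indices in
  \<open>{1, 2, 3, 4}\<close>.\<close>

lemma ip_lie_quad_grad_eq_0:
  assumes M: "M \<in> so4"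
    and "\<alpha>$1 * (\<alpha>'$3 - \<alpha>'$2) + \<alpha>$2 * (\<alpha>'$1 - \<alpha>'$3) + \<alpha>$3 * (\<alpha>'$2 - \<alpha>'$1) = 0"
    and "\<alpha>$1 * (\<beta>'$3 - \<beta>'$2) + \<beta>$2 * (\<alpha>'$1 - \<beta>'$3) + \<beta>$3 * (\<beta>'$2 - \<alpha>'$1) = 0"
    and "\<beta>$1 * (\<beta>'$3 - \<alpha>'$2) + \<alpha>$2 * (\<beta>'$1 - \<beta>'$3) + \<beta>$3 * (\<alpha>'$2 - \<beta>'$1) = 0"
    and "\<beta>$1 * (\<alpha>'$3 - \<beta>'$2) + \<beta>$2 * (\<beta>'$1 - \<alpha>'$3) + \<alpha>$3 * (\<beta>'$2 - \<beta>'$1) = 0"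
  shows "ip (quad_grad \<alpha> \<beta> M) (lie M (quad_grad \<alpha>' \<beta>' M)) = 0"
proof -
  obtain a1 a2 a3 b1 b2 b3 where X: "M = so4_mat a1 a2 a3 b1 b2 b3" using M by (rule so4E)
  have "ip (quad_grad \<alpha> \<beta> M) (lie M (quad_grad \<alpha>' \<beta>' M)) =
     (\<alpha>$1 * (\<alpha>'$3 - \<alpha>'$2) + \<alpha>$2 * (\<alpha>'$1 - \<alpha>'$3) + \<alpha>$3 * (\<alpha>'$2 - \<alpha>'$1)) * (a1 * a2 * a3)
   + (\<alpha>$1 * (\<beta>'$3 - \<beta>'$2) + \<beta>$2 * (\<alpha>'$1 - \<beta>'$3) + \<beta>$3 * (\<beta>'$2 - \<alpha>'$1)) * (a1 * b2 * b3)
   + (\<beta>$1 * (\<beta>'$3 - \<alpha>'$2) + \<alpha>$2 * (\<beta>'$1 - \<beta>'$3) + \<beta>$3 * (\<alpha>'$2 - \<beta>'$1)) * (b1 * a2 * b3)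
   + (\<beta>$1 * (\<alpha>'$3 - \<beta>'$2) + \<beta>$2 * (\<beta>'$1 - \<alpha>'$3) + \<alpha>$3 * (\<beta>'$2 - \<beta>'$1)) * (b1 * b2 * a3)"
    unfolding X quad_grad_so4_mat lie_so4_mat ip_so4_mat by (simp add: algebra_simps)
  then show ?thesis using assms by simp
qed

locale so4_body =
  fixes l :: "real^4"
  assumes decr: "l$1 > l$2" "l$2 > l$3" "l$3 > l$4"
    and sum_pos: "\<And>i j. i \<noteq> j \<Longrightarrow> l$i + l$j > 0"
begin

lemma sums_pos:
  "l$1 + l$2 > 0" "l$1 + l$3 > 0" "l$2 + l$3 > 0" "l$1 + l$4 > 0" "l$2 + l$4 > 0" "l$3 + l$4 > 0"
  by (rule sum_pos; simp)+

lemma sq_decr: "(l$1)\<^sup>2 > (l$2)\<^sup>2" "(l$2)\<^sup>2 > (l$3)\<^sup>2" "(l$3)\<^sup>2 > (l$4)\<^sup>2"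
proof -
  have "(l$i)\<^sup>2 > (l$j)\<^sup>2" if "l$i > l$j" "l$i + l$j > 0" for i j
    using mult_pos_pos[of "l$i - l$j" "l$i + l$j"] that by (simp add: power2_eq_square algebra_simps)
  then show "(l$1)\<^sup>2 > (l$2)\<^sup>2" "(l$2)\<^sup>2 > (l$3)\<^sup>2" "(l$3)\<^sup>2 > (l$4)\<^sup>2"
    using decr sums_pos by blast+
qed

lemma Omega_eq:
  assumes M: "M \<in> so4" shows "Omega l M = quad_grad (ham_x l) (ham_y l) M"
proof -
  obtain a1 a2 a3 b1 b2 b3 where X: "M = so4_mat a1 a2 a3 b1 b2 b3" using M by (rule so4E)
  have J: "J_mat l ** so4_mat c1 c2 c3 d1 d2 d3 + so4_mat c1 c2 c3 d1 d2 d3 ** J_mat l =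
     so4_mat ((l$2 + l$3) * c1) ((l$1 + l$3) * c2) ((l$1 + l$2) * c3)
       ((l$1 + l$4) * d1) ((l$2 + l$4) * d2) ((l$3 + l$4) * d3)" for c1 c2 c3 d1 d2 d3
    by (simp add: J_mat_def vec_eq_iff forall_4 matrix_matrix_mult_def sum_4 algebra_simps)
  show ?thesis
    unfolding Omega_def
  proof (rule the_equality)
    show "quad_grad (ham_x l) (ham_y l) M \<in> so4 \<and>
        M = J_mat l ** quad_grad (ham_x l) (ham_y l) M + quad_grad (ham_x l) (ham_y l) M ** J_mat l"
      using sums_pos unfolding X quad_grad_so4_mat J by (simp add: ham_x_def ham_y_def)
    fix W assume W: "W \<in> so4 \<and> M = J_mat l ** W + W ** J_mat l"
    then obtain c1 c2 c3 d1 d2 d3 where W': "W = so4_mat c1 c2 c3 d1 d2 d3" using so4E by blast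
    show "W = quad_grad (ham_x l) (ham_y l) M"
      using W[THEN conjunct2] sums_pos unfolding W' X J quad_grad_so4_mat so4_mat_eq_iff
      by (simp add: ham_x_def ham_y_def)
  qed
qed

lemma rigid_body_eq: "M \<in> so4 \<Longrightarrow> rigid_body l M = lie M (quad_grad (ham_x l) (ham_y l) M)"
  by (simp add: rigid_body_def Omega_eq)

text \<open>That the two basic integrals Poisson commute, and likewise their linearizations, follows from these
  two relations alone.\<close>

lemma partial_fractions:
  "1 / ((l$3)\<^sup>2 - (l$4)\<^sup>2) * (1 / ((l$1)\<^sup>2 - (l$3)\<^sup>2) - 1 / ((l$1)\<^sup>2 - (l$4)\<^sup>2)) =
     1 / ((l$1)\<^sup>2 - (l$3)\<^sup>2) * (1 / ((l$1)\<^sup>2 - (l$4)\<^sup>2))"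
  "1 / ((l$3)\<^sup>2 - (l$4)\<^sup>2) * (1 / ((l$2)\<^sup>2 - (l$3)\<^sup>2) - 1 / ((l$2)\<^sup>2 - (l$4)\<^sup>2)) =
     1 / ((l$2)\<^sup>2 - (l$3)\<^sup>2) * (1 / ((l$2)\<^sup>2 - (l$4)\<^sup>2))"
proof -
  have "1 / c * (1 / a - 1 / b) = 1 / a * (1 / b)" if "b = a + c" "a > 0" "c > 0" for a b c :: real
    using that by (simp add: field_simps)
  note * = this[where a = "x - (l$3)\<^sup>2" and b = "x - (l$4)\<^sup>2" and c = "(l$3)\<^sup>2 - (l$4)\<^sup>2" for x]
  show "1 / ((l$3)\<^sup>2 - (l$4)\<^sup>2) * (1 / ((l$1)\<^sup>2 - (l$3)\<^sup>2) - 1 / ((l$1)\<^sup>2 - (l$4)\<^sup>2)) =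
     1 / ((l$1)\<^sup>2 - (l$3)\<^sup>2) * (1 / ((l$1)\<^sup>2 - (l$4)\<^sup>2))"
  "1 / ((l$3)\<^sup>2 - (l$4)\<^sup>2) * (1 / ((l$2)\<^sup>2 - (l$3)\<^sup>2) - 1 / ((l$2)\<^sup>2 - (l$4)\<^sup>2)) =
     1 / ((l$2)\<^sup>2 - (l$3)\<^sup>2) * (1 / ((l$2)\<^sup>2 - (l$4)\<^sup>2))"
    by (rule *; use sq_decr in simp)+
qed

text \<open>Subtracting from \<open>b = \<lambda>\<close>, respectively \<open>b = 2 \<lambda>\<^sup>4\<close>, the affine function of \<open>\<lambda>\<^sup>2\<close> that agrees with it at
  \<open>\<lambda>\<^sub>1\<close> and \<open>\<lambda>\<^sub>2\<close> leaves \<open>b = (0, 0, -h3, -h4)\<close>, respectively \<open>(0, 0, -i3, -i4)\<close>.\<close>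

definition "h3 = (l$1 - l$3) * (l$2 - l$3) / (l$1 + l$2)"
definition "h4 = (l$1 - l$4) * (l$2 - l$4) / (l$1 + l$2)"
definition "i3 = - (2 * ((l$1)\<^sup>2 - (l$3)\<^sup>2) * ((l$2)\<^sup>2 - (l$3)\<^sup>2))"
definition "i4 = - (2 * ((l$1)\<^sup>2 - (l$4)\<^sup>2) * ((l$2)\<^sup>2 - (l$4)\<^sup>2))"

lemma H_lincomb:
  "ham_x l $ i = 1 / (l$1 + l$2) + h3 * trans_x l $ i + (h4 - h3) * 0 $ i"
  "ham_y l $ i = 1 / (l$1 + l$2) + h3 * trans_y l $ i + (h4 - h3) * fourth_y l $ i"
proof -
  have f: "x\<^sup>2 - y\<^sup>2 = (x - y) * (x + y)" for x y :: real
    by (simp add: power2_eq_square algebra_simps)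
  have 1: "1 / (y + z) = 1 / (x + y) + (x - z) * (y - z) / (x + y) * (1 / (y\<^sup>2 - z\<^sup>2))"
    if "y > z" "x + y > 0" "y + z > 0" for x y z :: real
    using that unfolding f by (simp add: divide_simps; simp add: algebra_simps)
  have 2: "1 / (x + z) = 1 / (x + y) + (x - z) * (y - z) / (x + y) * (1 / (x\<^sup>2 - z\<^sup>2))"
    if "x > z" "x + y > 0" "x + z > 0" for x y z :: real
    using that unfolding f by (simp add: divide_simps; simp add: algebra_simps)
  have 3: "1 / (z + t) = 1 / (x + y) + ((x - t) * (y - t) / (x + y) - (x - z) * (y - z) / (x + y)) * (1 / (z\<^sup>2 - t\<^sup>2))"
    if "z > t" "x + y > 0" "z + t > 0" for x y z t :: real
    using that unfolding f by (simp add: divide_simps; simp add: algebra_simps)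
  have e: "1 / (l$2 + l$3) = 1 / (l$1 + l$2) + h3 * (1 / ((l$2)\<^sup>2 - (l$3)\<^sup>2))"
      "1 / (l$1 + l$3) = 1 / (l$1 + l$2) + h3 * (1 / ((l$1)\<^sup>2 - (l$3)\<^sup>2))"
      "1 / (l$2 + l$4) = 1 / (l$1 + l$2) + h4 * (1 / ((l$2)\<^sup>2 - (l$4)\<^sup>2))"
      "1 / (l$1 + l$4) = 1 / (l$1 + l$2) + h4 * (1 / ((l$1)\<^sup>2 - (l$4)\<^sup>2))"
      "1 / (l$3 + l$4) = 1 / (l$1 + l$2) + (h4 - h3) * (1 / ((l$3)\<^sup>2 - (l$4)\<^sup>2))"
    unfolding h3_def h4_def
    by (rule 1 2 3; use decr sums_pos in linarith)+
  have "\<forall>i. ham_x l $ i = 1 / (l$1 + l$2) + h3 * trans_x l $ i + (h4 - h3) * 0 $ i"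
    unfolding forall_3 ham_x_def trans_x_def vector_3 zero_index e by simp
  moreover have "\<forall>i. ham_y l $ i = 1 / (l$1 + l$2) + h3 * trans_y l $ i + (h4 - h3) * fourth_y l $ i"
    unfolding forall_3 ham_y_def trans_y_def fourth_y_def vector_3 e by (simp flip: add_divide_distrib)
  ultimately show
    "ham_x l $ i = 1 / (l$1 + l$2) + h3 * trans_x l $ i + (h4 - h3) * 0 $ i"
    "ham_y l $ i = 1 / (l$1 + l$2) + h3 * trans_y l $ i + (h4 - h3) * fourth_y l $ i" by blast+
qed

lemma I_lincomb:
  "int_x l $ i = 2 * ((l$1)\<^sup>2 + (l$2)\<^sup>2) + i3 * trans_x l $ i + (i4 - i3) * 0 $ i"
  "int_y l $ i = 2 * ((l$1)\<^sup>2 + (l$2)\<^sup>2) + i3 * trans_y l $ i + (i4 - i3) * fourth_y l $ i"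
proof -
  have 1: "2 * (y + z) = 2 * (x + y) + - (2 * (x - z) * (y - z)) * (1 / (y - z))"
    if "y > z" for x y z :: real
    using that by (simp add: divide_simps; simp add: algebra_simps)
  have 2: "2 * (x + z) = 2 * (x + y) + - (2 * (x - z) * (y - z)) * (1 / (x - z))"
    if "x > z" for x y z :: real
    using that by (simp add: divide_simps; simp add: algebra_simps)
  have 3: "2 * (z + t) = 2 * (x + y) + (- (2 * (x - t) * (y - t)) - - (2 * (x - z) * (y - z))) * (1 / (z - t))"
    if "z > t" for x y z t :: real
    using that by (simp add: divide_simps; simp add: algebra_simps)
  have e: "2 * ((l$2)\<^sup>2 + (l$3)\<^sup>2) = 2 * ((l$1)\<^sup>2 + (l$2)\<^sup>2) + i3 * (1 / ((l$2)\<^sup>2 - (l$3)\<^sup>2))"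
      "2 * ((l$1)\<^sup>2 + (l$3)\<^sup>2) = 2 * ((l$1)\<^sup>2 + (l$2)\<^sup>2) + i3 * (1 / ((l$1)\<^sup>2 - (l$3)\<^sup>2))"
      "2 * ((l$2)\<^sup>2 + (l$4)\<^sup>2) = 2 * ((l$1)\<^sup>2 + (l$2)\<^sup>2) + i4 * (1 / ((l$2)\<^sup>2 - (l$4)\<^sup>2))"
      "2 * ((l$1)\<^sup>2 + (l$4)\<^sup>2) = 2 * ((l$1)\<^sup>2 + (l$2)\<^sup>2) + i4 * (1 / ((l$1)\<^sup>2 - (l$4)\<^sup>2))"
      "2 * ((l$3)\<^sup>2 + (l$4)\<^sup>2) = 2 * ((l$1)\<^sup>2 + (l$2)\<^sup>2) + (i4 - i3) * (1 / ((l$3)\<^sup>2 - (l$4)\<^sup>2))"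
    unfolding i3_def i4_def
    by (rule 1 2 3; use sq_decr in linarith)+
  have "\<forall>i. int_x l $ i = 2 * ((l$1)\<^sup>2 + (l$2)\<^sup>2) + i3 * trans_x l $ i + (i4 - i3) * 0 $ i"
    unfolding forall_3 int_x_def trans_x_def vector_3 zero_index e by simp
  moreover have "\<forall>i. int_y l $ i = 2 * ((l$1)\<^sup>2 + (l$2)\<^sup>2) + i3 * trans_y l $ i + (i4 - i3) * fourth_y l $ i"
    unfolding forall_3 int_y_def trans_y_def fourth_y_def vector_3 e by (simp flip: add_divide_distrib)
  ultimately show
    "int_x l $ i = 2 * ((l$1)\<^sup>2 + (l$2)\<^sup>2) + i3 * trans_x l $ i + (i4 - i3) * 0 $ i"
    "int_y l $ i = 2 * ((l$1)\<^sup>2 + (l$2)\<^sup>2) + i3 * trans_y l $ i + (i4 - i3) * fourth_y l $ i" by blast+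
qed

text \<open>The determinant of \<open>H\<close> and \<open>I\<close> in terms of the two basic integrals.  It is a nonzero multiple of
  \<open>(\<lambda>\<^sub>1 + \<lambda>\<^sub>3) (\<lambda>\<^sub>2 + \<lambda>\<^sub>3) - (\<lambda>\<^sub>1 + \<lambda>\<^sub>4) (\<lambda>\<^sub>2 + \<lambda>\<^sub>4)\<close>, which is positive because \<open>\<lambda>\<^sub>3 > \<lambda>\<^sub>4\<close>.\<close>

lemma H_I_independent: "h3 * (i4 - i3) \<noteq> i3 * (h4 - h3)"
proof -
  define X Y S where "X = (l$1 - l$3) * (l$2 - l$3)" and "Y = (l$1 - l$4) * (l$2 - l$4)" and "S = l$1 + l$2"
  define u v where "u = (l$1 + l$3) * (l$2 + l$3)" and "v = (l$1 + l$4) * (l$2 + l$4)"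
  have h: "h3 = X / S" "h4 = Y / S" by (simp_all add: h3_def h4_def X_def Y_def S_def)
  have i: "i3 = - 2 * X * u" "i4 = - 2 * Y * v"
    unfolding i3_def i4_def X_def Y_def u_def v_def by algebra+
  have pos: "X > 0" "Y > 0" "S > 0"
    using decr sums_pos by (simp_all add: X_def Y_def S_def)
  have "v < u"
    unfolding u_def v_def using decr sums_pos by (intro mult_strict_mono) auto
  then have "2 * X * Y / S * (u - v) \<noteq> 0" using pos by simp
  moreover have "h3 * (i4 - i3) - i3 * (h4 - h3) = 2 * X * Y / S * (u - v)"
    unfolding h i by (simp add: algebra_simps flip: add_divide_distrib diff_divide_distrib)
  ultimately show ?thesis by (metis right_minus_eq)
qed

lemma F_conserved:
  assumes "M \<in> so4" shows "ip (quad_grad (trans_x l) (trans_y l) M) (rigid_body l M) = 0"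
  unfolding rigid_body_eq[OF assms]
proof (rule ip_lie_quad_grad_eq_0[OF assms], unfold H_lincomb)
  define r13 r14 r23 r24 r34 where r: "r13 = 1 / ((l$1)\<^sup>2 - (l$3)\<^sup>2)" "r14 = 1 / ((l$1)\<^sup>2 - (l$4)\<^sup>2)"
    "r23 = 1 / ((l$2)\<^sup>2 - (l$3)\<^sup>2)" "r24 = 1 / ((l$2)\<^sup>2 - (l$4)\<^sup>2)" "r34 = 1 / ((l$3)\<^sup>2 - (l$4)\<^sup>2)"
  note coeffs = trans_x_def trans_y_def fourth_y_def r[symmetric] vector_3 zero_index
  note rel = partial_fractions[folded r]
  let ?c = "1 / (l$1 + l$2)"
  show "trans_x l$1 * (?c + h3 * trans_x l$3 + (h4 - h3) * 0$3 - (?c + h3 * trans_x l$2 + (h4 - h3) * 0$2))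
    + trans_x l$2 * (?c + h3 * trans_x l$1 + (h4 - h3) * 0$1 - (?c + h3 * trans_x l$3 + (h4 - h3) * 0$3))
    + trans_x l$3 * (?c + h3 * trans_x l$2 + (h4 - h3) * 0$2 - (?c + h3 * trans_x l$1 + (h4 - h3) * 0$1)) = 0"
    by (simp add: algebra_simps)
  show "trans_x l$1 * (?c + h3 * trans_y l$3 + (h4 - h3) * fourth_y l$3 - (?c + h3 * trans_y l$2 + (h4 - h3) * fourth_y l$2))
    + trans_y l$2 * (?c + h3 * trans_x l$1 + (h4 - h3) * 0$1 - (?c + h3 * trans_y l$3 + (h4 - h3) * fourth_y l$3))
    + trans_y l$3 * (?c + h3 * trans_y l$2 + (h4 - h3) * fourth_y l$2 - (?c + h3 * trans_x l$1 + (h4 - h3) * 0$1)) = 0"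
    unfolding coeffs using rel by algebra
  show "trans_y l$1 * (?c + h3 * trans_y l$3 + (h4 - h3) * fourth_y l$3 - (?c + h3 * trans_x l$2 + (h4 - h3) * 0$2))
    + trans_x l$2 * (?c + h3 * trans_y l$1 + (h4 - h3) * fourth_y l$1 - (?c + h3 * trans_y l$3 + (h4 - h3) * fourth_y l$3))
    + trans_y l$3 * (?c + h3 * trans_x l$2 + (h4 - h3) * 0$2 - (?c + h3 * trans_y l$1 + (h4 - h3) * fourth_y l$1)) = 0"
    unfolding coeffs using rel by algebra
  show "trans_y l$1 * (?c + h3 * trans_x l$3 + (h4 - h3) * 0$3 - (?c + h3 * trans_y l$2 + (h4 - h3) * fourth_y l$2))
    + trans_y l$2 * (?c + h3 * trans_y l$1 + (h4 - h3) * fourth_y l$1 - (?c + h3 * trans_x l$3 + (h4 - h3) * 0$3))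
    + trans_x l$3 * (?c + h3 * trans_y l$2 + (h4 - h3) * fourth_y l$2 - (?c + h3 * trans_y l$1 + (h4 - h3) * fourth_y l$1)) = 0"
    unfolding coeffs by (simp add: algebra_simps)
qed

section \<open>Non-degeneracy of the equilibria\<close>

context
  fixes p q :: real assumes pq: "p\<^sup>2 \<noteq> q\<^sup>2"
begin

lemma lin_op_commute: "commutator (lin_op p q 0 (fourth_y l)) (lin_op p q (trans_x l) (trans_y l)) = 0"
proof (rule commutator_eq_0I[OF subspace_tangent_M3[OF pq] lin_op_in_End_on[OF pq] lin_op_in_End_on[OF pq]])
  define r13 r14 r23 r24 r34 where r: "r13 = 1 / ((l$1)\<^sup>2 - (l$3)\<^sup>2)" "r14 = 1 / ((l$1)\<^sup>2 - (l$4)\<^sup>2)"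
    "r23 = 1 / ((l$2)\<^sup>2 - (l$3)\<^sup>2)" "r24 = 1 / ((l$2)\<^sup>2 - (l$4)\<^sup>2)" "r34 = 1 / ((l$3)\<^sup>2 - (l$4)\<^sup>2)"
  note coeffs = trans_x_def trans_y_def fourth_y_def r[symmetric] vector_3 zero_index
  note rel = partial_fractions[folded r]
  fix v assume "v \<in> tangent (M3 p q)"
  then obtain u1 u2 v1 v2 where v: "v = tvec u1 u2 v1 v2" by (rule tangent_M3E[OF pq])
  show "blinfun_apply (lin_op p q 0 (fourth_y l)) (blinfun_apply (lin_op p q (trans_x l) (trans_y l)) v) =
        blinfun_apply (lin_op p q (trans_x l) (trans_y l)) (blinfun_apply (lin_op p q 0 (fourth_y l)) v)"
    unfolding v lin_op_tvec so4_mat_eq_iff coeffs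
    by (intro conjI; (rule refl | use rel in algebra))
qed

lemma lin_op_independent: "lin_op p q 0 (fourth_y l) \<noteq> k *\<^sub>R lin_op p q (trans_x l) (trans_y l)"
proof
  define r13 r14 r23 r24 r34 where r: "r13 = 1 / ((l$1)\<^sup>2 - (l$3)\<^sup>2)" "r14 = 1 / ((l$1)\<^sup>2 - (l$4)\<^sup>2)"
    "r23 = 1 / ((l$2)\<^sup>2 - (l$3)\<^sup>2)" "r24 = 1 / ((l$2)\<^sup>2 - (l$4)\<^sup>2)" "r34 = 1 / ((l$3)\<^sup>2 - (l$4)\<^sup>2)"
  note coeffs = trans_x_def trans_y_def fourth_y_def r[symmetric] vector_3 zero_index
  have rpos: "r13 > 0" "r14 > 0" "r23 > 0" "r24 > 0" "r34 > 0" using sq_decr unfolding r by simp_all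
  assume eq: "lin_op p q 0 (fourth_y l) = k *\<^sub>R lin_op p q (trans_x l) (trans_y l)"
  have e: "blinfun_apply (lin_op p q 0 (fourth_y l)) v = k *\<^sub>R blinfun_apply (lin_op p q (trans_x l) (trans_y l)) v" for v
    by (simp add: eq blinfun.scaleR_left)
  have s: "k *\<^sub>R tvec a b c d = tvec (k * a) (k * b) (k * c) (k * d)" for a b c d
    by (simp add: vec_eq_iff forall_4)
  note e' = e[of "tvec 1 0 0 0", unfolded lin_op_tvec s so4_mat_eq_iff coeffs]
    e[of "tvec 0 0 1 0", unfolded lin_op_tvec s so4_mat_eq_iff coeffs]
  have k: "k * (p * r23) = 0" "k * (q * r23) = - (q * r34)" "k * (p * r14) = p * r14"
     "k * (q * r14) = q * (r14 - r34)"
    using e'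
    by auto
  show False
  proof (cases "p = 0")
    case False
    then show False using k rpos by auto
  next
    case True
    with pq have "q \<noteq> 0" by auto
    have "q * (k * r23) = q * (- r34)" "q * (k * r14) = q * (r14 - r34)"
      using k(2,4) by (simp_all add: mult.left_commute)
    then have "k * r23 = - r34" "k * r14 = r14 - r34"
      using \<open>q \<noteq> 0\<close> unfolding mult_cancel_left by simp_all
    then have *: "r34 * (r23 - r14) = r14 * r23" by algebra
    have "y - x = z" if "1 / z * (1 / x - 1 / y) = 1 / y * (1 / x)" "x > 0" "y > 0" "z > 0" for x y z :: real
    proof -
      have "(x * y) * (x + z) = (x * y) * y" using that by (simp add: field_simps)
      then show ?thesis using that unfolding mult_cancel_left by simp
    qed
    \<comment> \<open>In the remaining case the ratios would force \<open>\<lambda>\<^sub>1\<^sup>2 - \<lambda>\<^sub>4\<^sup>2 = \<lambda>\<^sub>2\<^sup>2 - \<lambda>\<^sub>4\<^sup>2\<close>.\<close>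
    from this[OF *[unfolded r]] show False using sq_decr by simp
  qed
qed

lemma nondegenerate_M3:
  assumes "M3 p q \<in> Orb c1 c2"
  shows "nondegenerate_center_center l c1 c2 (M3 p q)"
proof -
  let ?T = "tangent (M3 p q)" and ?w = "omega (M3 p q)"
  have "trans_x l $ 1 > 0" "trans_x l $ 2 > 0" "trans_y l $ 1 > 0" "trans_y l $ 2 > 0" "trans_x l $ 3 = 0" "trans_y l $ 3 = 0"
    using sq_decr by (simp_all add: trans_x_def trans_y_def)
  \<comment> \<open>The first inequality amounts to \<open>\<lambda>\<^sub>3\<^sup>2 > \<lambda>\<^sub>4\<^sup>2\<close>, the second to \<open>\<lambda>\<^sub>1\<^sup>2 > \<lambda>\<^sub>2\<^sup>2\<close>.\<close>
  moreover have "trans_x l $ 1 * trans_x l $ 2 > trans_y l $ 1 * trans_y l $ 2"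
    using sq_decr unfolding trans_x_def trans_y_def
    by (simp, subst mult.commute) (intro frac_less2 mult_strict_mono; simp)
  moreover have "trans_x l $ 1 * trans_y l $ 2 > trans_y l $ 1 * trans_x l $ 2"
    using sq_decr unfolding trans_x_def trans_y_def
    by (simp, subst mult.commute) (intro frac_less2 mult_strict_mono; simp)
  ultimately obtain \<phi> A B where "symplectic_frame ?T ?w \<phi>" and AB: "A \<noteq> 0" "B \<noteq> 0" "A\<^sup>2 \<noteq> B\<^sup>2"
    and L: "\<And>u. blinfun_apply (lin_op p q (trans_x l) (trans_y l)) (\<phi> u) = \<phi> (cc_matrix A B *v u)"
    using definite_center_center_frame[OF pq, of "trans_x l" "trans_y l"] by (metis less_irrefl)
  interpret symplectic_frame ?T ?w \<phi> by fact
  have gen: "linearizations_algebra l (M3 p q) = cc_algebra ?T \<phi>"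
    unfolding linearizations_algebra_def ham_H_quad int_I_quad linearization_quad[OF pq]
    by (rule cc_algebra_generated(1)[OF lin_op_in_End_on[OF pq] L AB lin_op_in_symp_alg[OF pq]
        lin_op_commute lin_op_independent lin_op_lincomb[OF pq H_lincomb] lin_op_lincomb[OF pq I_lincomb]
        H_I_independent])
  have cartan: "cartan_subalgebra commutator (symp_alg ?T ?w) (cc_algebra ?T \<phi>)"
    by (rule cc_algebra_generated(2)[OF lin_op_in_End_on[OF pq] L AB lin_op_in_symp_alg[OF pq]
        lin_op_commute lin_op_independent lin_op_lincomb[OF pq H_lincomb] lin_op_lincomb[OF pq I_lincomb]
        H_I_independent])
  have crit: "critical_on_orbit (quad \<alpha> \<beta>) (M3 p q)" for \<alpha> \<beta>
    unfolding critical_on_orbit_def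
    by (auto simp: grad_quad M3_def quad_grad_so4_mat ip_so4_mat elim!: tangent_M3E[OF pq, unfolded M3_def])
  have "rigid_body l (M3 p q) = 0"
    by (simp add: rigid_body_eq quad_grad_M3) (simp add: M3_def lie_so4_mat vec_eq_iff forall_4)
  then have "nondegenerate l c1 c2 (M3 p q)"
    unfolding nondegenerate_def using assms gen cartan crit by (simp add: ham_H_quad int_I_quad)
  moreover have "center_center_algebra ?T ?w (cc_algebra ?T \<phi>)"
    unfolding center_center_algebra_def cc_algebra_def
    using linear_frame bij_frame symplectic_frame by blast
  ultimately show ?thesis
    unfolding nondegenerate_center_center_def gen by blast
qed

end

end

section \<open>Lyapunov stability\<close>

lemma solution_conserved:
  assumes "solution_on f S T \<gamma>" "t \<in> {0..T}"
    and Q: "\<And>x. x \<in> S \<Longrightarrow> \<exists>D. (Q has_derivative D) (at x within S) \<and> D (f x) = (0::real)"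
  shows "Q (\<gamma> t) = Q (\<gamma> 0)"
proof -
  have "\<exists>c. \<forall>x\<in>{0..T}. Q (\<gamma> x) = c"
  proof (rule has_derivative_zero_constant)
    show "convex {0..T}" by simp
    fix x assume x: "x \<in> {0..T}"
    then obtain D where D: "(Q has_derivative D) (at (\<gamma> x) within S)" "D (f (\<gamma> x)) = 0"
      using Q assms(1) unfolding solution_on_def by blast
    have \<gamma>: "(\<gamma> has_derivative (\<lambda>h. h *\<^sub>R f (\<gamma> x))) (at x within {0..T})"
      using assms(1) x by (simp add: solution_on_def has_vector_derivative_def)
    have "\<gamma> ` {0..T} \<subseteq> S" using assms(1) by (auto simp: solution_on_def)
    then have "((\<lambda>t. Q (\<gamma> t)) has_derivative (\<lambda>h. D (h *\<^sub>R f (\<gamma> x)))) (at x within {0..T})"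
      by (intro has_derivative_in_compose[OF \<gamma>] has_derivative_subset[OF D(1)])
    moreover have "D (h *\<^sub>R f (\<gamma> x)) = 0" for h
      using linear_scale[OF has_derivative_linear[OF D(1)]] D(2) by simp
    ultimately show "((\<lambda>t. Q (\<gamma> t)) has_derivative (\<lambda>h. 0)) (at x within {0..T})" by simp
  qed
  then show ?thesis using assms(2) by force
qed

text \<open>A solution starting close to \<open>p\<close> has a value of \<open>V\<close> below the minimum of \<open>V\<close> on a small sphere
  around \<open>p\<close>; it cannot cross that sphere, where \<open>V\<close> would have to be larger.\<close>

lemma lyapunov_stable_isolated_minimum:
  fixes p :: "'a::euclidean_space"
  assumes S: "closed S" "p \<in> S" and "f p = 0" and cont: "continuous_on S V"
    and min: "V p = (0::real)" "\<And>x. x \<in> S \<Longrightarrow> V x \<ge> 0"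
    and fin: "finite {x \<in> S. V x = 0}"
    and cons: "\<And>T \<gamma> t. solution_on f S T \<gamma> \<Longrightarrow> t \<in> {0..T} \<Longrightarrow> V (\<gamma> t) = V (\<gamma> 0)"
  shows "lyapunov_stable f S p"
  unfolding lyapunov_stable_def
proof (intro conjI allI impI)
  fix \<epsilon> :: real assume "\<epsilon> > 0"
  obtain r where r: "r > 0" "\<forall>x\<in>{x \<in> S. V x = 0}. x \<noteq> p \<longrightarrow> r \<le> dist p x"
    using finite_set_avoid[OF fin] by blast
  define e where "e = min \<epsilon> r / 2"
  have e: "0 < e" "e < \<epsilon>" "e < r" using \<open>\<epsilon> > 0\<close> r(1) by (auto simp: e_def min_def)
  let ?K = "sphere p e \<inter> S"
  have Kpos: "V x > 0" if "x \<in> ?K" for x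
  proof -
    have "x \<in> S" "dist p x = e" using that by auto
    then have "V x \<noteq> 0" using r(2) e S(2) by auto
    then show ?thesis using min(2)[OF \<open>x \<in> S\<close>] by simp
  qed
  obtain m where m: "m > 0" "\<And>x. x \<in> ?K \<Longrightarrow> m \<le> V x"
  proof (cases "?K = {}")
    case True then show ?thesis using that[of 1] by auto
  next
    case False
    have "compact ?K" using S(1) by (intro compact_Int_closed compact_sphere)
    moreover have "continuous_on ?K V" using cont by (rule continuous_on_subset) simp
    ultimately obtain x where "x \<in> ?K" "\<forall>y\<in>?K. V x \<le> V y"
      using continuous_attains_inf[OF _ False] by blast
    then show ?thesis using that[of "V x"] Kpos by blast
  qed
  obtain d where d: "d > 0" "\<And>x. x \<in> S \<Longrightarrow> dist x p < d \<Longrightarrow> dist (V x) (V p) < m"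
    using cont S(2) m(1) unfolding continuous_on_iff by blast
  show "\<exists>\<delta>>0. \<forall>T\<ge>0. \<forall>\<gamma>. solution_on f S T \<gamma> \<and> dist (\<gamma> 0) p < \<delta> \<longrightarrow> (\<forall>t\<in>{0..T}. dist (\<gamma> t) p < \<epsilon>)"
  proof (intro exI[of _ "min d e"] conjI allI impI ballI)
    show "min d e > 0" using d e by simp
    fix T :: real and \<gamma> t
    assume sol: "solution_on f S T \<gamma> \<and> dist (\<gamma> 0) p < min d e" and t: "t \<in> {0..T}"
    have "\<gamma> 0 \<in> S" using sol t by (auto simp: solution_on_def)
    show "dist (\<gamma> t) p < \<epsilon>"
    proof (rule ccontr)
      assume "\<not> dist (\<gamma> t) p < \<epsilon>"
      have "continuous_on {0..T} \<gamma>"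
        using sol unfolding solution_on_def continuous_on_eq_continuous_within
        by (auto intro: has_vector_derivative_continuous)
      then have c: "continuous_on {0..t} (\<lambda>s. dist (\<gamma> s) p)"
        using t by (intro continuous_intros) (auto intro: continuous_on_subset)
      have "\<exists>s. 0 \<le> s \<and> s \<le> t \<and> dist (\<gamma> s) p = e"
        using \<open>\<not> dist (\<gamma> t) p < \<epsilon>\<close> e sol t by (intro IVT'[OF _ _ _ c]) auto
      then obtain s where s: "0 \<le> s" "s \<le> t" "dist (\<gamma> s) p = e" by blast
      then have "\<gamma> s \<in> ?K" using sol t by (auto simp: solution_on_def dist_commute)
      then have "m \<le> V (\<gamma> s)" by (rule m(2))
      also have "V (\<gamma> s) = V (\<gamma> 0)" by (rule cons[of T]) (use sol s t in simp_all)
      also have "\<dots> < m" using d(2)[OF \<open>\<gamma> 0 \<in> S\<close>] sol min(1) by (simp add: dist_real_def)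
      finally show False by simp
    qed
  qed
qed (use assms in auto)

lemma lyapunov_stable_subset:
  assumes "lyapunov_stable f S p" "S' \<subseteq> S" "p \<in> S'"
  shows "lyapunov_stable f S' p"
proof -
  have "solution_on f S T \<gamma>" if "solution_on f S' T \<gamma>" for T \<gamma>
    using that assms(2) by (auto simp: solution_on_def)
  then show ?thesis using assms unfolding lyapunov_stable_def by meson
qed

lemma M3_in_Orb_iff: "M3 p q \<in> Orb c1 c2 \<longleftrightarrow> p\<^sup>2 + q\<^sup>2 = 2 * c1 \<and> p * q = c2"
  by (auto simp: Orb_def C1_def C2_def M3_def)

lemma M3_eq_iff: "M3 p q = M3 p' q' \<longleftrightarrow> p = p' \<and> q = q'"
  by (simp add: M3_def so4_mat_eq_iff)

text \<open>The conditions \<open>p\<^sup>2 + q\<^sup>2 = 2 c1\<close>, \<open>p q = c2\<close> prescribe \<open>(p + q)\<^sup>2\<close> and \<open>(p - q)\<^sup>2\<close>; both values are positive,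
  so there are four choices of signs.\<close>

lemma t3_Int_Orb:
  assumes "c1 > \<bar>c2\<bar>"
  obtains a b where "t3 \<inter> Orb c1 c2 = {M3 a b, M3 (- a) (- b), M3 b a, M3 (- b) (- a)}" "a\<^sup>2 \<noteq> b\<^sup>2"
proof -
  define s d where "s = sqrt (2 * (c1 + c2))" and "d = sqrt (2 * (c1 - c2))"
  have sd: "s > 0" "d > 0" "s\<^sup>2 = 2 * (c1 + c2)" "d\<^sup>2 = 2 * (c1 - c2)" using assms by (auto simp: s_def d_def)
  define a b where "a = (s + d) / 2" and "b = (s - d) / 2"
  have ab: "s = a + b" "d = a - b" by (simp_all add: a_def b_def field_simps)
  have on: "p\<^sup>2 + q\<^sup>2 = 2 * c1 \<and> p * q = c2 \<longleftrightarrow> (p + q)\<^sup>2 = s\<^sup>2 \<and> (p - q)\<^sup>2 = d\<^sup>2" for p q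
    unfolding sd(3,4) power2_sum power2_diff by auto
  have "p\<^sup>2 + q\<^sup>2 = 2 * c1 \<and> p * q = c2 \<longleftrightarrow>
      (p = a \<and> q = b) \<or> (p = - a \<and> q = - b) \<or> (p = b \<and> q = a) \<or> (p = - b \<and> q = - a)" for p q
    unfolding on power2_eq_iff ab by auto
  then have "t3 \<inter> Orb c1 c2 = {M3 a b, M3 (- a) (- b), M3 b a, M3 (- b) (- a)}"
    by (auto simp: t3_def M3_in_Orb_iff)
  moreover have "a\<^sup>2 \<noteq> b\<^sup>2" using sd(1,2) unfolding ab power2_eq_iff by auto
  ultimately show ?thesis by (rule that)
qed

lemma card_t3_Int_Orb:
  assumes "c1 > \<bar>c2\<bar>" shows "card (t3 \<inter> Orb c1 c2) = 4"
proof -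
  obtain a b where ab: "t3 \<inter> Orb c1 c2 = {M3 a b, M3 (- a) (- b), M3 b a, M3 (- b) (- a)}" "a\<^sup>2 \<noteq> b\<^sup>2"
    using t3_Int_Orb[OF assms] by blast
  then have "a \<noteq> b" "a \<noteq> - b" "a \<noteq> 0 \<or> b \<noteq> 0" by auto
  then show ?thesis unfolding ab(1) by (auto simp: M3_eq_iff card_insert_if)
qed

context so4_body
begin

definition lyapunov_fun :: "real \<Rightarrow> real \<Rightarrow> mat4 \<Rightarrow> real" where
  "lyapunov_fun c1 c2 M = quad (trans_x l) (trans_y l) M + (C1 M - c1)\<^sup>2 + (C2 M - c2)\<^sup>2"

lemma F_nonneg: "quad (trans_x l) (trans_y l) M \<ge> 0"
  using sq_decr by (simp add: quad_def trans_x_def trans_y_def)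

lemma F_eq_0_iff:
  assumes "M \<in> so4" shows "quad (trans_x l) (trans_y l) M = 0 \<longleftrightarrow> M \<in> t3"
proof
  assume z: "quad (trans_x l) (trans_y l) M = 0"
  have pos: "trans_x l $ 1 > 0" "trans_x l $ 2 > 0" "trans_y l $ 1 > 0" "trans_y l $ 2 > 0" "trans_x l $ 3 = 0" "trans_y l $ 3 = 0"
    using sq_decr by (simp_all add: trans_x_def trans_y_def)
  have sum0: "a = 0 \<and> b = 0 \<and> c = 0 \<and> d = 0"
    if "a + b + (c + d) = 0" "a \<ge> 0" "b \<ge> 0" "c \<ge> 0" "d \<ge> 0" for a b c d :: real
    using that by linarith
  have "trans_x l $ 1 * (x1 M)\<^sup>2 = 0 \<and> trans_x l $ 2 * (x2 M)\<^sup>2 = 0 \<and> trans_y l $ 1 * (y1 M)\<^sup>2 = 0 \<and> trans_y l $ 2 * (y2 M)\<^sup>2 = 0"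
    by (rule sum0) (use z pos in \<open>simp_all add: quad_def\<close>)
  then have "x1 M = 0" "x2 M = 0" "y1 M = 0" "y2 M = 0" using pos by simp_all
  then have "M = M3 (x3 M) (y3 M)"
    using so4_mat_of_coords[OF assms] by (simp add: M3_def)
  then show "M \<in> t3" unfolding t3_def by blast
qed (auto simp: t3_def M3_def quad_def trans_x_def trans_y_def)

lemma C1_quad: "C1 = quad 1 1"
  by (simp add: fun_eq_iff C1_def quad_def)

lemma C1_conserved: "M \<in> so4 \<Longrightarrow> ip (quad_grad 1 1 M) (rigid_body l M) = 0"
  unfolding rigid_body_eq by (rule ip_lie_quad_grad_eq_0) (auto simp: algebra_simps)

lemma C2_has_derivative:
  "(C2 has_derivative (\<lambda>X. x1 M * y1 X + y1 M * x1 X + x2 M * y2 X + y2 M * x2 X + x3 M * y3 X + y3 M * x3 X))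
     (at M within so4)"
  unfolding C2_def[abs_def]
  by (auto intro!: derivative_eq_intros bounded_linear_coords[THEN bounded_linear.has_derivative[OF _ has_derivative_ident]]
      simp: algebra_simps)

lemma C2_conserved:
  assumes "M \<in> so4"
  defines "X \<equiv> rigid_body l M"
  shows "x1 M * y1 X + y1 M * x1 X + x2 M * y2 X + y2 M * x2 X + x3 M * y3 X + y3 M * x3 X = 0"
proof -
  obtain a1 a2 a3 b1 b2 b3 where M: "M = so4_mat a1 a2 a3 b1 b2 b3" using assms(1) by (rule so4E)
  show ?thesis
    unfolding X_def rigid_body_eq[OF assms(1)] unfolding M quad_grad_so4_mat lie_so4_mat so4_mat_coords
    by (simp add: algebra_simps)
qed

lemma lyapunov_fun_conserved:
  assumes "solution_on (rigid_body l) so4 T \<gamma>" "t \<in> {0..T}"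
  shows "lyapunov_fun c1 c2 (\<gamma> t) = lyapunov_fun c1 c2 (\<gamma> 0)"
proof -
  note cons = solution_conserved[OF assms]
  have "quad (trans_x l) (trans_y l) (\<gamma> t) = quad (trans_x l) (trans_y l) (\<gamma> 0)"
    by (rule cons) (use quad_has_derivative F_conserved in blast)
  moreover have "C1 (\<gamma> t) = C1 (\<gamma> 0)"
    unfolding C1_quad by (rule cons) (use quad_has_derivative C1_conserved in blast)
  moreover have "C2 (\<gamma> t) = C2 (\<gamma> 0)"
    by (rule cons) (use C2_has_derivative C2_conserved in blast)
  ultimately show ?thesis by (simp add: lyapunov_fun_def)
qed

lemma continuous_on_lyapunov_fun: "continuous_on so4 (lyapunov_fun c1 c2)"
  unfolding lyapunov_fun_def[abs_def] quad_def[abs_def] C1_def C2_def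
  by (intro continuous_intros bounded_linear_coords[THEN bounded_linear.continuous_on])

lemma lyapunov_stable_so4:
  assumes "c1 > \<bar>c2\<bar>" "M \<in> t3 \<inter> Orb c1 c2" "rigid_body l M = 0"
  shows "lyapunov_stable (rigid_body l) so4 M"
proof (rule lyapunov_stable_isolated_minimum[where V = "lyapunov_fun c1 c2"])
  have zero: "lyapunov_fun c1 c2 N = 0 \<longleftrightarrow> N \<in> t3 \<inter> Orb c1 c2" if "N \<in> so4" for N
  proof -
    have "lyapunov_fun c1 c2 N = 0 \<longleftrightarrow> quad (trans_x l) (trans_y l) N = 0 \<and> C1 N = c1 \<and> C2 N = c2"
      using F_nonneg[of N] by (simp add: lyapunov_fun_def add_nonneg_eq_0_iff)
    then show ?thesis using that F_eq_0_iff by (auto simp: Orb_def)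
  qed
  show "closed so4" by (rule closed_subspace[OF subspace_so4])
  show "M \<in> so4" using assms(2) by (simp add: Orb_def)
  then show "lyapunov_fun c1 c2 M = 0" using zero assms(2) by blast
  show "lyapunov_fun c1 c2 N \<ge> 0" for N
    using F_nonneg[of N] by (simp add: lyapunov_fun_def)
  have "finite (t3 \<inter> Orb c1 c2)" using card_t3_Int_Orb[OF assms(1)] card_ge_0_finite by force
  then show "finite {N \<in> so4. lyapunov_fun c1 c2 N = 0}"
    by (rule finite_subset[rotated]) (use zero in blast)
qed (rule assms(3) continuous_on_lyapunov_fun lyapunov_fun_conserved; assumption)+

end

theorem theorem5p6:
  fixes l :: "real^4" and c1 c2 :: real
  assumes "l$1 > l$2" and "l$2 > l$3" and "l$3 > l$4"
    and "\<And>i j. i \<noteq> j \<Longrightarrow> l$i + l$j > 0"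
    and "c1 > \<bar>c2\<bar>"
  shows "card (t3 \<inter> Orb c1 c2) = 4 \<and>
    (\<forall>M \<in> t3 \<inter> Orb c1 c2.
       nondegenerate_center_center l c1 c2 M \<and>
       lyapunov_stable (rigid_body l) (Orb c1 c2) M \<and>
       lyapunov_stable (rigid_body l) so4 M)"
proof (intro conjI ballI)
  interpret so4_body l by unfold_locales (use assms in auto)
  show "card (t3 \<inter> Orb c1 c2) = 4" by (rule card_t3_Int_Orb[OF assms(5)])
  fix M assume M: "M \<in> t3 \<inter> Orb c1 c2"
  then obtain p q where pq: "M = M3 p q" by (auto simp: t3_def)
  have "p\<^sup>2 \<noteq> q\<^sup>2"
  proof -
    obtain a b where "t3 \<inter> Orb c1 c2 = {M3 a b, M3 (- a) (- b), M3 b a, M3 (- b) (- a)}" "a\<^sup>2 \<noteq> b\<^sup>2"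
      using t3_Int_Orb[OF assms(5)] by blast
    then show ?thesis using M by (auto simp: pq M3_eq_iff)
  qed
  then show nd: "nondegenerate_center_center l c1 c2 M"
    using M unfolding pq by (intro nondegenerate_M3) auto
  show so4: "lyapunov_stable (rigid_body l) so4 M"
    using assms(5) M nd
    by (intro lyapunov_stable_so4) (auto simp: nondegenerate_center_center_def nondegenerate_def)
  show "lyapunov_stable (rigid_body l) (Orb c1 c2) M"
    using M by (intro lyapunov_stable_subset[OF so4]) (auto simp: Orb_def)
qed

end
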